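(* Let $k=k_n$ and $m=m_n$ be integer sequences with $n>2k_n$, $0\le m_n\le\lfloor(n-2k_n)/2\rfloor$, $\lim_{n\to\infty}k_n=\infty$, and such that for every $\epsilon>0$ $$\sum_n 2(k_n+1)\exp\Bigg(-(n-2k_n)\Big[\frac{\epsilon^2}{2(k_n+1)L_{\max}^2}-2|\mathcal Z|^{2k_n}\Big\{h\Big(\frac{m_n}{n-2k_n}\Big)+\frac{(m_n+1)\ln N}{n-2k_n}\Big\}\Big]\Bigg)<\infty,$$ with $h(x)=-x\ln x-(1-x)\ln(1-x)$ and $N=|\mathcal S|$. Let $\hat{\mathbf X}^n$ be the $(k_n,m_n)$-S-DUDE. Then for every process distribution $P_{\mathbf X}\in\mathcal P\{m_n\}$, $$\lim_{n\to\infty}\Big[E\,L_{\hat{\mathbf X}^n}(X^n,Z^n)-\mathbb D(P_{X^n},\Pi)\Big]=0,$$ where $X^n$ is drawn from $P_{X^n}$ and $Z^n$ is the output of the channel $\Pi$ with input $X^n$.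
   Context: Let $\mathcal X,\mathcal Z,\hat{\mathcal X}$ be finite alphabets and $\Pi=\{\Pi(x,z)\}$ a $|\mathcal X|\times|\mathcal Z|$ stochastic matrix (discrete memoryless channel) of full row rank; given input $X^n$, the outputs $Z_t$ are conditionally independent with $\Pr(Z_t=z\mid X^n)=\Pi(X_t,z)$. Fix a loss $\Lambda:\mathcal X\times\hat{\mathcal X}\to[0,\infty)$, $\Lambda_{\max}=\max\Lambda$. Let $\mathcal S$ be the set of maps $\mathcal Z\to\hat{\mathcal X}$; fix a real $|\mathcal Z|\times|\mathcal X|$ matrix $H$ with $\Pi H=I$ and let $h(z)$ be the column vector equal to its $z$-th row; $\rho_x(s)=\sum_z\Lambda(x,s(z))\Pi(x,z)$; $\ell(z,s)=h(z)^T\rho(s)$; $\ell_{\max}=\max_{z,s}\ell-\min_{z,s}\ell$; $L_{\max}=\Lambda_{\max}+\ell_{\max}$. An $n$-block denoiser is $\hat{\mathbf X}^n=(\hat X_t)_{t=1}^n$, $\hat X_t:\mathcal Z^n\to\hat{\mathcal X}$, with $L_{\hat{\mathbf X}^n}(x^n,z^n)=\frac1n\sum_t\Lambda(x_t,\hat X_t(z^n))$; $\mathbb D(P_{X^n},\Pi)=\min_{\hat{\mathbf X}^n}E\,L_{\hat{\mathbf X}^n}(X^n,Z^n)$, the minimum over all $n$-block denoisers. S-DUDE: for $z^n$ and $k+1\le t\le n-k$, $\mathbf c_t=(z_{t-k}^{t-1},z_{t+1}^{t+k})$, $\mathcal T(\mathbf c)=\{t:k+1\le t\le n-k,\mathbf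 c_t=\mathbf c\}$; $\mathcal S^n_{k,m}(z^n)$ is the set of $(\sigma_{k+1},\dots,\sigma_{n-k})\in\mathcal S^{n-2k}$ such that for every $\mathbf c\in\mathcal Z^{2k}$, writing $\mathcal T(\mathbf c)=\{\tau_1<\dots<\tau_r\}$, at most $m$ indices $j<r$ have $\sigma_{\tau_j}\ne\sigma_{\tau_{j+1}}$. The $(k,m)$-S-DUDE outputs $\hat X_t(z^n)=\hat\sigma_t(z_t)$ for $k+1\le t\le n-k$, where $(\hat\sigma_t)$ minimizes $\frac1{n-2k}\sum_{t=k+1}^{n-k}\ell(z_t,\sigma_t)$ over $\mathcal S^n_{k,m}(z^n)$, and a fixed arbitrary symbol for other $t$. Class $\mathcal P\{m_n\}$: a distribution $P_{\mathbf X}$ on $\mathcal X^\infty$ belongs to it if there exist $M\ge1$, distributions $P^{(1)},\dots,P^{(M)}$ of stationary processes with values in $\mathcal X$, and a process $\mathbf A$ with values in $\{1,\dots,M\}$ such that $r(A^n)=\sum_{j=1}^{n-1}\mathbf 1_{\{A_j\ne A_{j+1}\}}\le m_n$ a.s. for all $n$, and for all $n$, $P_{X^n}(x^n)=\sum_{a^n}P_{A^n}(a^n)\prod_{i=1}^{r+1}P^{(a_{\tau_i})}(x_{\tau_{i-1}+1}^{\tau_i})$, where $r=r(a^n)$, $\tau_0=0$, $\tau_{r+1}=n$, and for $1\le i\le r$, $\tau_i$ is the smallest $t$ with $\sum_{j=1}^t\mathbf 1_{\{a_j\ne a_{j+1}\}}=i$ (the end of the $i$-th constant block), and $P^{(a)}(x_1^\ell)$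 denotes the probability the stationary process $P^{(a)}$ assigns to its first $\ell$ symbols being $x_1^\ell$. *)

theory Defs
  imports "HOL-Probability.Probability"
begin

text \<open>Conventions: time indices are 0-based (paper's t = our t+1); finite strings are lists.
 Alphabets X, Z, hat X are finite types; a process with values in a set A is a probability
 measure on the product space nat => A (product sigma-algebra).\<close>

definition seqM :: "(nat \<Rightarrow> 'a) measure" where
  "seqM = Pi\<^sub>M UNIV (\<lambda>_::nat. count_space (UNIV :: 'a set))"

definition is_process :: "(nat \<Rightarrow> 'a) measure \<Rightarrow> bool" where
  "is_process P \<longleftrightarrow> prob_space P \<and> sets P = sets seqM"

definition is_stationary :: "(nat \<Rightarrow> 'a) measure \<Rightarrow> bool" where
  "is_stationary P \<longleftrightarrow> is_process P \<and> distr P seqM (\<lambda>\<omega> i. \<omega> (Suc i)) = P"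

definition pfx :: "(nat \<Rightarrow> 'a) measure \<Rightarrow> 'a list \<Rightarrow> real" where
  "pfx P xs = measure P {\<omega> \<in> space P. \<forall>i<length xs. \<omega> i = xs ! i}"

definition nswitch :: "'a list \<Rightarrow> nat" where
  "nswitch as = card {j. Suc j < length as \<and> as ! j \<noteq> as ! Suc j}"

definition block_ends :: "'a list \<Rightarrow> nat list" where
  "block_ends as = sorted_list_of_set
     {t. 0 < t \<and> t \<le> length as \<and> (t = length as \<or> as ! (t - 1) \<noteq> as ! t)}"

definition block_prod :: "(nat \<Rightarrow> (nat \<Rightarrow> 'x) measure) \<Rightarrow> nat list \<Rightarrow> 'x list \<Rightarrow> real" where
  "block_prod Q as xs =
     (let \<tau> = block_ends as; st = 0 # \<tau> in
      \<Prod>i<length \<tau>. pfx (Q (as ! (\<tau> ! i - 1))) (take (\<tau> ! i - st ! i) (drop (st ! i) xs)))"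

definition classP :: "(nat \<Rightarrow> nat) \<Rightarrow> (nat \<Rightarrow> 'x) measure \<Rightarrow> bool" where
  "classP m P \<longleftrightarrow> is_process P \<and>
     (\<exists>M::nat. M \<ge> 1 \<and> (\<exists>(Q :: nat \<Rightarrow> (nat \<Rightarrow> 'x) measure) (A :: (nat \<Rightarrow> nat) measure).
        (\<forall>a\<in>{1..M}. is_stationary (Q a)) \<and> is_process A \<and>
        (AE \<omega> in A. \<forall>i. \<omega> i \<in> {1..M}) \<and>
        (\<forall>n. AE \<omega> in A. nswitch (map \<omega> [0..<n]) \<le> m n) \<and>
        (\<forall>xs. pfx P xs =
           (\<Sum>as\<in>{as. length as = length xs \<and> set as \<subseteq> {1..M}}. pfx A as * block_prod Q as xs))))"

definition stochastic :: "('x::finite \<Rightarrow> 'z::finite \<Rightarrow> real) \<Rightarrow> bool" where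
  "stochastic Ch \<longleftrightarrow> (\<forall>x z. Ch x z \<ge> 0) \<and> (\<forall>x. (\<Sum>z\<in>UNIV. Ch x z) = 1)"

definition full_row_rank :: "('x::finite \<Rightarrow> 'z::finite \<Rightarrow> real) \<Rightarrow> bool" where
  "full_row_rank Ch \<longleftrightarrow> (\<forall>c::'x \<Rightarrow> real. (\<forall>z. (\<Sum>x\<in>UNIV. c x * Ch x z) = 0) \<longrightarrow> (\<forall>x. c x = 0))"

definition right_inverse :: "('x::finite \<Rightarrow> 'z::finite \<Rightarrow> real) \<Rightarrow> ('z \<Rightarrow> 'x \<Rightarrow> real) \<Rightarrow> bool" where
  "right_inverse Ch H \<longleftrightarrow> (\<forall>x x'. (\<Sum>z\<in>UNIV. Ch x z * H z x') = (if x = x' then 1 else 0))"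

definition rho :: "('x::finite \<Rightarrow> 'z::finite \<Rightarrow> real) \<Rightarrow> ('x \<Rightarrow> 'xh \<Rightarrow> real) \<Rightarrow> 'x \<Rightarrow> ('z \<Rightarrow> 'xh) \<Rightarrow> real" where
  "rho Ch \<Lambda> x s = (\<Sum>z\<in>UNIV. \<Lambda> x (s z) * Ch x z)"

definition ell :: "('x::finite \<Rightarrow> 'z::finite \<Rightarrow> real) \<Rightarrow> ('z \<Rightarrow> 'x \<Rightarrow> real) \<Rightarrow> ('x \<Rightarrow> 'xh \<Rightarrow> real)
    \<Rightarrow> 'z \<Rightarrow> ('z \<Rightarrow> 'xh) \<Rightarrow> real" where
  "ell Ch H \<Lambda> z s = (\<Sum>x\<in>UNIV. H z x * rho Ch \<Lambda> x s)"

definition ell_max :: "('x::finite \<Rightarrow> 'z::finite \<Rightarrow> real) \<Rightarrow> ('z \<Rightarrow> 'x \<Rightarrow> real) \<Rightarrow> ('x \<Rightarrow> 'xh::finite \<Rightarrow> real) \<Rightarrow> real" where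
  "ell_max Ch H \<Lambda> = Max (range (\<lambda>(z, s). ell Ch H \<Lambda> z s)) - Min (range (\<lambda>(z, s). ell Ch H \<Lambda> z s))"

definition Lambda_max :: "('x::finite \<Rightarrow> 'xh::finite \<Rightarrow> real) \<Rightarrow> real" where
  "Lambda_max \<Lambda> = Max (range (\<lambda>(x, y). \<Lambda> x y))"

definition L_max :: "('x::finite \<Rightarrow> 'z::finite \<Rightarrow> real) \<Rightarrow> ('z \<Rightarrow> 'x \<Rightarrow> real) \<Rightarrow> ('x \<Rightarrow> 'xh::finite \<Rightarrow> real) \<Rightarrow> real" where
  "L_max Ch H \<Lambda> = Lambda_max \<Lambda> + ell_max Ch H \<Lambda>"

definition hb :: "real \<Rightarrow> real" where
  "hb x = (if x = 0 \<or> x = 1 then 0 else - x * ln x - (1 - x) * ln (1 - x))"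

text \<open>An n-block denoiser: D zs t is hat X_t(z^n) (t = 0..n-1).
 Expected loss E L(X^n, Z^n), with Z^n the memoryless channel output.\<close>
definition exp_loss :: "('x::finite \<Rightarrow> 'z::finite \<Rightarrow> real) \<Rightarrow> ('x \<Rightarrow> 'xh \<Rightarrow> real) \<Rightarrow> (nat \<Rightarrow> 'x) measure
    \<Rightarrow> nat \<Rightarrow> ('z list \<Rightarrow> nat \<Rightarrow> 'xh) \<Rightarrow> real" where
  "exp_loss Ch \<Lambda> P n D =
     (\<Sum>xs\<in>{xs. length xs = n}. \<Sum>zs\<in>{zs. length zs = n}.
        pfx P xs * (\<Prod>t<n. Ch (xs ! t) (zs ! t)) * ((1 / real n) * (\<Sum>t<n. \<Lambda> (xs ! t) (D zs t))))"

definition DD :: "('x::finite \<Rightarrow> 'z::finite \<Rightarrow> real) \<Rightarrow> ('x \<Rightarrow> 'xh \<Rightarrow> real) \<Rightarrow> (nat \<Rightarrow> 'x) measure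
    \<Rightarrow> nat \<Rightarrow> real" where
  "DD Ch \<Lambda> P n = (INF D. exp_loss Ch \<Lambda> P n D)"

text \<open>S-DUDE. Positions t with k <= t < n-k (paper: k+1..n-k).\<close>
definition ctx :: "nat \<Rightarrow> 'z list \<Rightarrow> nat \<Rightarrow> 'z list \<times> 'z list" where
  "ctx k zs t = (take k (drop (t - k) zs), take k (drop (Suc t) zs))"

definition Tset :: "nat \<Rightarrow> 'z list \<Rightarrow> 'z list \<times> 'z list \<Rightarrow> nat set" where
  "Tset k zs c = {t. k \<le> t \<and> t < length zs - k \<and> ctx k zs t = c}"

definition Skm :: "nat \<Rightarrow> nat \<Rightarrow> 'z list \<Rightarrow> (nat \<Rightarrow> ('z \<Rightarrow> 'xh)) set" where
  "Skm k m zs = {\<sigma>. \<forall>c. card {(i, j). i \<in> Tset k zs c \<and> j \<in> Tset k zs c \<and> i < j \<and>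
       (\<forall>l\<in>Tset k zs c. \<not> (i < l \<and> l < j)) \<and> \<sigma> i \<noteq> \<sigma> j} \<le> m}"

definition sdude_cost :: "('x::finite \<Rightarrow> 'z::finite \<Rightarrow> real) \<Rightarrow> ('z \<Rightarrow> 'x \<Rightarrow> real) \<Rightarrow> ('x \<Rightarrow> 'xh \<Rightarrow> real)
    \<Rightarrow> nat \<Rightarrow> 'z list \<Rightarrow> (nat \<Rightarrow> ('z \<Rightarrow> 'xh)) \<Rightarrow> real" where
  "sdude_cost Ch H \<Lambda> k zs \<sigma> =
     (1 / real (length zs - 2 * k)) * (\<Sum>t\<in>{k..<length zs - k}. ell Ch H \<Lambda> (zs ! t) (\<sigma> t))"

text \<open>D is a (k,m)-S-DUDE for block length n (any tie-breaking among minimizers).\<close>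
definition is_sdude :: "('x::finite \<Rightarrow> 'z::finite \<Rightarrow> real) \<Rightarrow> ('z \<Rightarrow> 'x \<Rightarrow> real) \<Rightarrow> ('x \<Rightarrow> 'xh \<Rightarrow> real)
    \<Rightarrow> nat \<Rightarrow> nat \<Rightarrow> nat \<Rightarrow> ('z list \<Rightarrow> nat \<Rightarrow> 'xh) \<Rightarrow> bool" where
  "is_sdude Ch H \<Lambda> k m n D \<longleftrightarrow> (\<exists>x0. \<forall>zs. length zs = n \<longrightarrow>
     (\<exists>\<sigma>\<in>Skm k m zs. (\<forall>\<sigma>'\<in>Skm k m zs. sdude_cost Ch H \<Lambda> k zs \<sigma> \<le> sdude_cost Ch H \<Lambda> k zs \<sigma>') \<and>
        (\<forall>t<n. D zs t = (if k \<le> t \<and> t < n - k then \<sigma> t (zs ! t) else x0))))"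

end

theory Submission
  imports Defs
begin

text \<open>
  Condition on the regime string \<open>A\<^sup>n\<close>. The law of \<open>X\<^sup>n\<close> is then a product of stationary blocks, so a
  denoiser that even knows \<open>A\<^sup>n\<close> cannot at time \<open>t\<close> beat the Bayes risk of an observation window
  inside the current block. By stationarity this risk is at least the limit \<open>d\<^sub>a\<close> of the decreasing
  sequence of risks of the best \<open>k\<close>-window denoisers of the current stationary source \<open>P\<^sup>(\<^sup>a\<^sup>)\<close>.

  Conversely, the genie that uses the best \<open>k\<close>-window rule of the current source has at most \<open>m\<close>
  shifts along each context and attains risk close to \<open>d\<^sub>a\<close> except within distance \<open>k\<close> of the at most
  \<open>m\<close> switches. The S-DUDE minimizes the estimated loss, which is unbiased for every rule sequence that
  does not look at the current symbol. So it remains to bound, uniformly over all rule sequences with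
  at most \<open>m\<close> shifts per context, how far the true loss exceeds its estimate. Along a residue class
  modulo \<open>k + 1\<close> the deviations are independent given the contexts, hence an exponential moment bound
  and a count of the admissible sequences suffice. Summability forces the logarithm of this count,
  times \<open>(k + 1) / (n - 2k)\<close>, and also \<open>(k + 1) (m + 1) / (n - 2k)\<close> to vanish.
\<close>

subsection \<open>Strings and the memoryless channel\<close>

text \<open>The obstacle is a double dependence on the observed string: the minimizing rule sequence
  is chosen from all of it, and so is the set of competitors, since contexts consist of observed
  symbols. Once the symbols off one residue class are frozen, the contexts on that class are frozen
  as well, and the competitors form a fixed finite set. Every one of the \<open>k + 1\<close>
  classes pays for the full count; this is the origin of the factor \<open>k + 1\<close>.

  Since only an expected loss is to be bounded, the exponential bound is used in expectation with a
  free parameter \<open>l\<close>. The resulting error per position is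
  \<open>(k + 1) * b / l + l * M\<^sup>2\<close>, where \<open>b\<close> bounds the logarithm of the
  count per position. For fixed \<open>l\<close> the first term vanishes as the length grows, and
  only then is the second made small.

  The optimal risk is never computed. The sum of the values \<open>bayes_lim\<close> along the
  regime string mediates: it lies below the loss of every denoiser and, up to the error, above that
  of the S-DUDE.\<close>

abbreviation words :: "nat \<Rightarrow> 'a list set" where
  "words n \<equiv> {xs. length xs = n}"

lemma finite_words [simp]: "finite (words n :: 'a::finite list set)"
  using finite_lists_length_eq[of "UNIV :: 'a set" n] by simp

lemma card_words: "card (words n :: 'a::finite list set) = CARD('a) ^ n"
  using card_lists_length_eq[of "UNIV :: 'a set" n] by simp

lemma sum_words_append:
  fixes f :: "'a::finite list \<Rightarrow> real"
  shows "(\<Sum>xs\<in>words (a + b). f xs) = (\<Sum>u\<in>words a. \<Sum>v\<in>words b. f (u @ v))"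
  unfolding sum.cartesian_product
  by (rule sum.reindex_bij_witness[where i = "\<lambda>(u, v). u @ v" and j = "\<lambda>xs. (take a xs, drop a xs)"])
    auto

lemma sum_words_Suc:
  fixes f :: "'a::finite list \<Rightarrow> real"
  shows "(\<Sum>xs\<in>words (Suc n). f xs) = (\<Sum>x\<in>UNIV. \<Sum>v\<in>words n. f (x # v))"
  unfolding sum.cartesian_product
  by (rule sum.reindex_bij_witness[where i = "\<lambda>(u, v). u # v" and j = "\<lambda>xs. (hd xs, tl xs)"])
    (auto simp: length_Suc_conv)

lemma sum_words_1:
  fixes f :: "'a::finite list \<Rightarrow> real"
  shows "(\<Sum>xs\<in>words (Suc 0). f xs) = (\<Sum>x\<in>UNIV. f [x])"
  using sum_words_Suc[of f 0] by simp

definition chn :: "('x \<Rightarrow> 'z \<Rightarrow> real) \<Rightarrow> 'x list \<Rightarrow> 'z list \<Rightarrow> real" where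
  "chn Ch xs zs = (\<Prod>t<length xs. Ch (xs ! t) (zs ! t))"

lemma chn_Nil [simp]: "chn Ch [] zs = 1"
  by (simp add: chn_def)

lemma chn_Cons [simp]: "chn Ch (x # xs) (z # zs) = Ch x z * chn Ch xs zs"
  by (simp add: chn_def prod.lessThan_Suc_shift del: prod.lessThan_Suc)

lemma chn_append:
  "length u = length zu \<Longrightarrow> chn Ch (u @ v) (zu @ zv) = chn Ch u zu * chn Ch v zv"
  by (induction u zu rule: list_induct2) auto

lemma chn_nonneg: "stochastic Ch \<Longrightarrow> 0 \<le> chn Ch xs zs"
  by (simp add: chn_def stochastic_def prod_nonneg)

lemma sum_chn:
  assumes "stochastic Ch" "length xs = n"
  shows "(\<Sum>zs\<in>words n. chn Ch xs zs) = 1"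
  using assms(2)
proof (induction xs arbitrary: n)
  case (Cons x xs)
  then show ?case using assms(1)
    by (auto simp: sum_words_Suc stochastic_def simp flip: sum_distrib_left)
qed simp

text \<open>Given the input, the output symbols are independent, so redrawing one of them does not
  change the law of the output. This identity stands in for conditioning on the other
  coordinates.\<close>

lemma chn_resample:
  assumes "stochastic Ch" "t < length xs" "length xs = n"
  shows "(\<Sum>zs\<in>words n. chn Ch xs zs * F zs) =
    (\<Sum>zs\<in>words n. chn Ch xs zs * (\<Sum>z\<in>UNIV. Ch (xs ! t) z * F (zs[t := z])))"
  using assms(2,3)
proof (induction xs arbitrary: t F n)
  case (Cons x xs)
  let ?n = "length xs"
  have n: "n = Suc ?n" using Cons.prems by simp
  show ?case
  proof (cases t)
    case 0
    have "(\<Sum>z\<in>UNIV. \<Sum>v\<in>words ?n. Ch x z * chn Ch xs v * (\<Sum>y\<in>UNIV. Ch x y * F (y # v)))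
        = (\<Sum>z\<in>UNIV. Ch x z) * (\<Sum>v\<in>words ?n. chn Ch xs v * (\<Sum>y\<in>UNIV. Ch x y * F (y # v)))"
      by (simp add: sum_product mult.assoc)
    also have "\<dots> = (\<Sum>v\<in>words ?n. \<Sum>y\<in>UNIV. Ch x y * chn Ch xs v * F (y # v))"
      using assms(1) by (simp add: stochastic_def sum_distrib_left mult_ac)
    also have "\<dots> = (\<Sum>y\<in>UNIV. \<Sum>v\<in>words ?n. Ch x y * chn Ch xs v * F (y # v))"
      by (rule sum.swap)
    finally show ?thesis
      using 0 n by (simp add: sum_words_Suc)
  next
    case (Suc t')
    then have "t' < ?n" using Cons.prems by simp
    note IH = Cons.IH[OF this refl]
    have "(\<Sum>v\<in>words ?n. Ch x z * chn Ch xs v * F (z # v)) =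
      (\<Sum>v\<in>words ?n. Ch x z * chn Ch xs v * (\<Sum>y\<in>UNIV. Ch (xs ! t') y * F (z # v[t' := y])))" for z
      using IH[of "\<lambda>v. F (z # v)"] by (simp add: mult.assoc flip: sum_distrib_left)
    then show ?thesis
      using Suc n by (simp add: sum_words_Suc)
  qed
qed simp

text \<open>The factors at \<open>T\<close> are integrated out one coordinate at a time, which is
  possible because \<open>\<phi>\<close> ignores these coordinates. Later \<open>\<phi>\<close> is
  the indicator that a fixed rule sequence is admissible, and the factors are exponentials of
  deviations.\<close>

lemma chn_prod_bound:
  assumes st: "stochastic Ch" and n: "length xs = n"
    and T: "finite T" "T \<subseteq> {..<n}"
    and inv: "\<And>t zs z. t \<in> T \<Longrightarrow> length zs = n \<Longrightarrow> \<phi> (zs[t := z]) = \<phi> zs"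
    and pos: "\<And>zs. 0 \<le> \<phi> zs" "\<And>t z. 0 \<le> g t z"
    and b: "\<And>t. t \<in> T \<Longrightarrow> (\<Sum>z\<in>UNIV. Ch (xs ! t) z * g t z) \<le> b" "0 \<le> b"
  shows "(\<Sum>zs\<in>words n. chn Ch xs zs * (\<phi> zs * (\<Prod>t\<in>T. g t (zs ! t))))
    \<le> b ^ card T * (\<Sum>zs\<in>words n. chn Ch xs zs * \<phi> zs)"
  using T inv b(1)
proof (induction T rule: finite_induct)
  case (insert t0 T)
  let ?G = "\<lambda>zs. \<phi> zs * (\<Prod>t\<in>T. g t (zs ! t))"
  let ?s = "\<Sum>z\<in>UNIV. Ch (xs ! t0) z * g t0 z"
  have t0: "t0 < n" using insert.prems by auto
  have G: "?G (zs[t0 := z]) = ?G zs" if "length zs = n" for zs z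
  proof -
    have "(\<Prod>t\<in>T. g t (zs[t0 := z] ! t)) = (\<Prod>t\<in>T. g t (zs ! t))"
    proof (rule prod.cong[OF refl])
      fix t assume "t \<in> T"
      then have "t0 \<noteq> t" using insert.hyps by auto
      then show "g t (zs[t0 := z] ! t) = g t (zs ! t)" by simp
    qed
    then show ?thesis using insert.prems(2)[of t0 zs z] that by simp
  qed
  have "(\<Sum>zs\<in>words n. chn Ch xs zs * (\<phi> zs * (\<Prod>t\<in>insert t0 T. g t (zs ! t))))
    = (\<Sum>zs\<in>words n. chn Ch xs zs * (?G zs * g t0 (zs ! t0)))"
    using insert.hyps by (simp add: mult_ac)
  also have "\<dots> = (\<Sum>zs\<in>words n. chn Ch xs zs *
      (\<Sum>z\<in>UNIV. Ch (xs ! t0) z * (?G (zs[t0 := z]) * g t0 (zs[t0 := z] ! t0))))"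
    by (rule chn_resample) (use st t0 n in auto)
  also have "\<dots> = (\<Sum>zs\<in>words n. chn Ch xs zs * (?G zs * ?s))"
  proof (rule sum.cong[OF refl])
    fix zs :: "'b list" assume "zs \<in> words n"
    then have "length zs = n" by simp
    then have "(\<Sum>z\<in>UNIV. Ch (xs ! t0) z * (?G (zs[t0 := z]) * g t0 (zs[t0 := z] ! t0)))
      = (\<Sum>z\<in>UNIV. ?G zs * (Ch (xs ! t0) z * g t0 z))"
      using t0 G by (intro sum.cong) (simp_all add: mult_ac)
    then show "chn Ch xs zs * (\<Sum>z\<in>UNIV. Ch (xs ! t0) z * (?G (zs[t0 := z]) * g t0 (zs[t0 := z] ! t0)))
      = chn Ch xs zs * (?G zs * ?s)"
      by (simp add: sum_distrib_left)
  qed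
  also have "\<dots> = (\<Sum>zs\<in>words n. chn Ch xs zs * ?G zs) * ?s"
    by (simp add: sum_distrib_right mult.assoc)
  also have "\<dots> \<le> (\<Sum>zs\<in>words n. chn Ch xs zs * ?G zs) * b"
    using insert.prems(3)[of t0]
    by (intro mult_left_mono sum_nonneg mult_nonneg_nonneg prod_nonneg chn_nonneg st) (auto simp: pos)
  also have "\<dots> \<le> (b ^ card T * (\<Sum>zs\<in>words n. chn Ch xs zs * \<phi> zs)) * b"
    using insert.prems by (intro mult_right_mono insert.IH b(2)) auto
  finally show ?case
    using insert.hyps by (simp add: mult_ac)
qed simp

section \<open>Exponential moments of bounded centred variables\<close>

lemma exp_le_quadratic:
  fixes u :: real
  assumes "\<bar>u\<bar> \<le> 1"
  shows "exp u \<le> 1 + u + u\<^sup>2"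
proof (cases "u \<ge> 0")
  case False
  define v where "v = - u"
  have v: "0 \<le> v" using False by (simp add: v_def)
  \<comment> \<open>The right-hand side equals \<open>1 + v^3\<close>.\<close>
  have "1 \<le> (1 - v + v\<^sup>2) * (1 + v)"
    using v by (simp add: algebra_simps power2_eq_square)
  also have "\<dots> \<le> (1 - v + v\<^sup>2) * exp v"
  proof (rule mult_left_mono)
    show "0 \<le> 1 - v + v\<^sup>2" using assms by (simp add: v_def)
  qed (rule exp_ge_add_one_self)
  finally have "exp (- v) \<le> 1 - v + v\<^sup>2"
    by (simp add: exp_minus field_simps)
  then show ?thesis by (simp add: v_def)
qed (use assms exp_bound in auto)

text \<open>In the second-order expansion the linear term vanishes by centring. The constant is not
  sharp, but only the order \<open>l\<^sup>2\<close> matters, because \<open>l\<close> ends up as a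
  small constant.\<close>

lemma mgf_bound:
  fixes p y :: "'z::finite \<Rightarrow> real"
  assumes p: "\<And>z. 0 \<le> p z" "(\<Sum>z\<in>UNIV. p z) = 1" and mean: "(\<Sum>z\<in>UNIV. p z * y z) = 0"
    and M: "\<And>z. \<bar>y z\<bar> \<le> M" and l: "0 \<le> l" "l * M \<le> 1"
  shows "(\<Sum>z\<in>UNIV. p z * exp (l * y z)) \<le> exp (l\<^sup>2 * M\<^sup>2)"
proof -
  have "(\<Sum>z\<in>UNIV. p z * exp (l * y z)) \<le> (\<Sum>z\<in>UNIV. p z * (1 + l * y z + l\<^sup>2 * M\<^sup>2))"
  proof (intro sum_mono mult_left_mono p)
    fix z
    have 1: "\<bar>l * y z\<bar> \<le> l * M"
      using M[of z] l by (simp add: abs_mult mult_left_mono)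
    then have "(l * y z)\<^sup>2 \<le> (l * M)\<^sup>2"
      by (simp add: abs_le_square_iff[symmetric])
    moreover have "exp (l * y z) \<le> 1 + l * y z + (l * y z)\<^sup>2"
      using 1 l by (intro exp_le_quadratic) simp
    ultimately show "exp (l * y z) \<le> 1 + l * y z + l\<^sup>2 * M\<^sup>2"
      by (simp add: power_mult_distrib)
  qed
  also have "\<dots> = (\<Sum>z\<in>UNIV. p z) + l * (\<Sum>z\<in>UNIV. p z * y z) + (\<Sum>z\<in>UNIV. p z) * (l\<^sup>2 * M\<^sup>2)"
    unfolding sum_distrib_right sum_distrib_left sum.distrib[symmetric]
    by (intro sum.cong) (auto simp: algebra_simps)
  also have "\<dots> \<le> exp (l\<^sup>2 * M\<^sup>2)"
    using exp_ge_add_one_self[of "l\<^sup>2 * M\<^sup>2"] by (simp add: p mean)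
  finally show ?thesis .
qed

subsection \<open>Sequences with few shifts\<close>

text \<open>The set counted in \<open>Skm\<close>, over an arbitrary index set, so that a context
  class, its part in a residue class and the whole time axis can be compared.\<close>

definition shifts :: "nat set \<Rightarrow> (nat \<Rightarrow> 'b) \<Rightarrow> (nat \<times> nat) set" where
  "shifts A \<sigma> = {(i, j). i \<in> A \<and> j \<in> A \<and> i < j \<and> (\<forall>l\<in>A. \<not> (i < l \<and> l < j)) \<and> \<sigma> i \<noteq> \<sigma> j}"

lemma finite_shifts: "finite A \<Longrightarrow> finite (shifts A \<sigma>)"
  by (rule finite_subset[of _ "A \<times> A"]) (auto simp: shifts_def)

lemma shifts_cong: "(\<And>t. t \<in> A \<Longrightarrow> \<sigma> t = \<sigma>' t) \<Longrightarrow> shifts A \<sigma> = shifts A \<sigma>'"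
  by (auto simp: shifts_def)

lemma card_shifts_insert:
  assumes "finite A" and b: "\<And>a. a \<in> A \<Longrightarrow> a < b"
  shows "card (shifts (insert b A) \<sigma>) =
    card (shifts A \<sigma>) + (if A \<noteq> {} \<and> \<sigma> (Max A) \<noteq> \<sigma> b then 1 else 0)"
proof (cases "A = {}")
  case True
  then have "shifts (insert b A) \<sigma> = {}" "shifts A \<sigma> = {}" by (auto simp: shifts_def)
  then show ?thesis using True by simp
next
  case False
  have M: "Max A \<in> A" "\<And>a. a \<in> A \<Longrightarrow> a \<le> Max A" using assms(1) False by auto
  have eq: "shifts (insert b A) \<sigma> = shifts A \<sigma> \<union> (if \<sigma> (Max A) \<noteq> \<sigma> b then {(Max A, b)} else {})"
  proof (rule set_eqI)
    fix p :: "nat \<times> nat"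
    obtain i j where p: "p = (i, j)" by (cases p)
    have nb: "b \<notin> A" using b by auto
    show "p \<in> shifts (insert b A) \<sigma> \<longleftrightarrow>
      p \<in> shifts A \<sigma> \<union> (if \<sigma> (Max A) \<noteq> \<sigma> b then {(Max A, b)} else {})"
    proof (cases "j = b")
      case True
      have "(i, b) \<in> shifts (insert b A) \<sigma> \<longleftrightarrow> i = Max A \<and> \<sigma> i \<noteq> \<sigma> b"
      proof
        assume a: "(i, b) \<in> shifts (insert b A) \<sigma>"
        then have "i \<in> A" by (auto simp: shifts_def)
        moreover have "\<not> i < Max A" using a M b by (auto simp: shifts_def)
        ultimately show "i = Max A \<and> \<sigma> i \<noteq> \<sigma> b" using M a by (auto simp: shifts_def intro: antisym)
      next
        assume "i = Max A \<and> \<sigma> i \<noteq> \<sigma> b"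
        then show "(i, b) \<in> shifts (insert b A) \<sigma>" using M b by (fastforce simp: shifts_def)
      qed
      moreover have "(i, b) \<notin> shifts A \<sigma>" using nb by (auto simp: shifts_def)
      ultimately show ?thesis using p True by auto
    next
      case False
      have "i \<noteq> b \<and> \<not> b < j" if "j \<in> A" "i < j"
        using b[OF that(1)] that(2) by auto
      then have "(i, j) \<in> shifts (insert b A) \<sigma> \<longleftrightarrow> (i, j) \<in> shifts A \<sigma>"
        using False unfolding shifts_def by blast
      then show ?thesis using p False by simp
    qed
  qed
  have "(Max A, b) \<notin> shifts A \<sigma>" using b by (auto simp: shifts_def)
  then show ?thesis using eq False finite_shifts[OF assms(1), of \<sigma>] by simp
qed

text \<open>Removing positions creates new neighbouring pairs, so the sets of shifts are not nested.
  Their sizes still compare, since a change across a gap forces a change somewhere inside the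
  gap.\<close>

lemma card_shifts_mono:
  assumes "finite A" "A' \<subseteq> A"
  shows "card (shifts A' \<sigma>) \<le> card (shifts A \<sigma>)"
proof -
  \<comment> \<open>The extra term records a change between the last kept position and the last
    position of \<open>A\<close>. It pays for the shift that appears when a new maximum is joined to
    an \<open>A'\<close> that ends before \<open>A\<close> does.\<close>
  have "\<forall>A'\<subseteq>A. card (shifts A' \<sigma>) + (if A' \<noteq> {} \<and> \<sigma> (Max A') \<noteq> \<sigma> (Max A) then 1 else 0)
    \<le> card (shifts A \<sigma>)"
    using assms(1)
  proof (induction A rule: finite_linorder_max_induct)
    case empty
    then show ?case by simp
  next
    case (insert b A)
    have Mb: "Max (insert b A) = b"
      using insert.hyps by (intro Max_eqI) auto
    have ins: "card (shifts (insert b A) \<sigma>) =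
      card (shifts A \<sigma>) + (if A \<noteq> {} \<and> \<sigma> (Max A) \<noteq> \<sigma> b then 1 else 0)"
      using insert.hyps by (intro card_shifts_insert) auto
    show ?case
    proof (intro allI impI)
      fix A' assume A': "A' \<subseteq> insert b A"
      show "card (shifts A' \<sigma>) + (if A' \<noteq> {} \<and> \<sigma> (Max A') \<noteq> \<sigma> (Max (insert b A)) then 1 else 0)
        \<le> card (shifts (insert b A) \<sigma>)"
      proof (cases "b \<in> A'")
        case True
        define B where "B = A' - {b}"
        have B: "A' = insert b B" "B \<subseteq> A" using True A' by (auto simp: B_def)
        have fB: "finite B" using B insert.hyps finite_subset by blast
        have MB: "Max (insert b B) = b"
          using insert.hyps fB B by (intro Max_eqI) (auto intro: less_imp_le)
        have "card (shifts (insert b B) \<sigma>) =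
          card (shifts B \<sigma>) + (if B \<noteq> {} \<and> \<sigma> (Max B) \<noteq> \<sigma> b then 1 else 0)"
          using insert.hyps B fB by (intro card_shifts_insert) auto
        then show ?thesis
          using insert.IH[rule_format, OF B(2)] B Mb MB ins by (auto split: if_splits)
      next
        case False
        then have "A' \<subseteq> A" using A' by auto
        then show ?thesis
          using insert.IH[rule_format, OF \<open>A' \<subseteq> A\<close>] Mb ins by (auto split: if_splits)
      qed
    qed
  qed
  then show ?thesis using assms(2) by (meson add_leD1)
qed

text \<open>The value at the largest position either repeats the preceding one or uses up one of the
  \<open>m\<close> shifts; adding the two counts is Pascal's rule. One factor
  \<open>CARD('b)\<close> pays for the initial value and one for each shift.\<close>

lemma card_few_shifts:
  assumes "finite A"
  shows "card {\<sigma> \<in> A \<rightarrow>\<^sub>E (UNIV :: 'b::finite set). card (shifts A \<sigma>) \<le> m}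
    \<le> CARD('b) ^ (m + 1) * (\<Sum>j\<le>m. card A choose j)"
  using assms
proof (induction A arbitrary: m rule: finite_linorder_max_induct)
  case empty
  have "{\<sigma> \<in> {} \<rightarrow>\<^sub>E (UNIV :: 'b set). card (shifts {} \<sigma>) \<le> m} \<subseteq> {\<lambda>_. undefined}" by auto
  then have "card {\<sigma> \<in> {} \<rightarrow>\<^sub>E (UNIV :: 'b set). card (shifts {} \<sigma>) \<le> m} \<le> 1"
    using card_mono[of "{\<lambda>_::nat. undefined :: 'b}"] by fastforce
  also have "\<dots> \<le> CARD('b) ^ (m + 1) * (\<Sum>j\<le>m. card ({} :: nat set) choose j)"
    by (simp add: Suc_le_eq sum_pos2[of _ 0])
  finally show ?case .
next
  case (insert b A)
  let ?N = "CARD('b)"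
  define G where "G = (\<lambda>A m. {\<sigma> \<in> A \<rightarrow>\<^sub>E (UNIV :: 'b set). card (shifts A \<sigma>) \<le> m})"
  have bA: "b \<notin> A" using insert.hyps by auto
  have cA: "card (insert b A) = Suc (card A)" using bA insert.hyps by simp
  have finG: "finite (G B k)" if "finite B" for B k
    unfolding G_def by (rule finite_subset[OF _ finite_PiE[OF that, of "\<lambda>_. UNIV"]]) auto
  have ins: "card (shifts (insert b A) \<sigma>) =
      card (shifts A \<sigma>) + (if A \<noteq> {} \<and> \<sigma> (Max A) \<noteq> \<sigma> b then 1 else 0)" for \<sigma> :: "nat \<Rightarrow> 'b"
    using insert.hyps by (intro card_shifts_insert) auto
  have rs: "shifts A (restrict \<sigma> A) = shifts A \<sigma>" for \<sigma> :: "nat \<Rightarrow> 'b"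
    by (rule shifts_cong) simp
  have inj2: "inj_on (\<lambda>\<sigma>. (\<sigma> b, restrict \<sigma> A)) (insert b A \<rightarrow>\<^sub>E (UNIV :: 'b set))"
  proof (rule inj_onI)
    fix \<sigma> \<sigma>' :: "nat \<Rightarrow> 'b"
    assume P: "\<sigma> \<in> insert b A \<rightarrow>\<^sub>E UNIV" "\<sigma>' \<in> insert b A \<rightarrow>\<^sub>E UNIV"
      and e: "(\<sigma> b, restrict \<sigma> A) = (\<sigma>' b, restrict \<sigma>' A)"
    show "\<sigma> = \<sigma>'"
    proof (rule PiE_ext[OF P])
      fix t assume "t \<in> insert b A"
      then show "\<sigma> t = \<sigma>' t" using e by (auto dest: fun_cong[of _ _ t])
    qed
  qed
  have IH: "card (G A m) \<le> ?N ^ (m + 1) * (\<Sum>j\<le>m. card A choose j)" for m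
    using insert.IH by (simp add: G_def)
  show ?case
  proof (cases "A = {}")
    case True
    have "card (insert b A \<rightarrow>\<^sub>E (UNIV :: 'b set)) = ?N"
      using True by (simp add: card_PiE)
    moreover have "finite (insert b A \<rightarrow>\<^sub>E (UNIV :: 'b set))"
      using insert.hyps by (intro finite_PiE) auto
    moreover have "G (insert b A) m \<subseteq> insert b A \<rightarrow>\<^sub>E (UNIV :: 'b set)"
      by (simp add: G_def)
    ultimately have "card (G (insert b A) m) \<le> ?N"
      using card_mono by metis
    also have "\<dots> \<le> ?N ^ (m + 1) * 1" by simp
    also have "\<dots> \<le> ?N ^ (m + 1) * (\<Sum>j\<le>m. card (insert b A) choose j)"
      by (intro mult_left_mono) (auto simp: Suc_le_eq sum_pos2[of _ 0])
    finally show ?thesis by (simp add: G_def)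
  next
    case False
    define S1 where "S1 = {\<sigma> \<in> G (insert b A) m. \<sigma> b = \<sigma> (Max A)}"
    define S2 where "S2 = {\<sigma> \<in> G (insert b A) m. \<sigma> b \<noteq> \<sigma> (Max A)}"
    have un: "G (insert b A) m = S1 \<union> S2" by (auto simp: S1_def S2_def)
    have c1: "card S1 \<le> card (G A m)"
    proof (rule card_inj_on_le)
      show "inj_on (\<lambda>\<sigma>. restrict \<sigma> A) S1"
      proof (rule inj_onI)
        fix \<sigma> \<sigma>' assume s: "\<sigma> \<in> S1" "\<sigma>' \<in> S1" and e: "restrict \<sigma> A = restrict \<sigma>' A"
        have "Max A \<in> A" using False insert.hyps by simp
        then have "\<sigma> (Max A) = \<sigma>' (Max A)" using e by (auto dest: fun_cong[of _ _ "Max A"])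
        then have "(\<sigma> b, restrict \<sigma> A) = (\<sigma>' b, restrict \<sigma>' A)" using s e by (simp add: S1_def)
        then show "\<sigma> = \<sigma>'"
          by (rule inj_onD[OF inj2]) (use s in \<open>simp_all add: S1_def G_def\<close>)
      qed
      show "(\<lambda>\<sigma>. restrict \<sigma> A) ` S1 \<subseteq> G A m"
        by (auto simp: S1_def G_def rs ins False)
    qed (use finG insert.hyps in auto)
    show ?thesis
    proof (cases m)
      case 0
      have "S2 = {}" using 0 False by (auto simp: S2_def G_def ins split: if_splits)
      then have "card (G (insert b A) m) \<le> ?N ^ (m + 1) * (\<Sum>j\<le>m. card A choose j)"
        using c1 IH[of m] un by simp
      then show ?thesis using 0 by (simp add: G_def)
    next
      case (Suc m')
      have "card S2 \<le> card ((UNIV :: 'b set) \<times> G A m')"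
      proof (rule card_inj_on_le)
        show "inj_on (\<lambda>\<sigma>. (\<sigma> b, restrict \<sigma> A)) S2"
          by (rule inj_on_subset[OF inj2]) (auto simp: S2_def G_def)
        show "(\<lambda>\<sigma>. (\<sigma> b, restrict \<sigma> A)) ` S2 \<subseteq> UNIV \<times> G A m'"
          using Suc False by (auto simp: S2_def G_def rs ins)
      qed (use finG insert.hyps in auto)
      then have "card S2 \<le> ?N * card (G A m')" by (simp add: card_cartesian_product)
      also have "\<dots> \<le> ?N * (?N ^ (m' + 1) * (\<Sum>j\<le>m'. card A choose j))"
        by (intro mult_left_mono IH) simp
      finally have c2: "card S2 \<le> ?N ^ (m + 1) * (\<Sum>j\<le>m'. card A choose j)"
        using Suc by simp
      have "card (G (insert b A) m) \<le> card S1 + card S2"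
        unfolding un by (rule card_Un_le)
      also have "\<dots> \<le> ?N ^ (m + 1) * ((\<Sum>j\<le>m. card A choose j) + (\<Sum>j\<le>m'. card A choose j))"
        using c1 c2 IH[of m] by (simp add: distrib_left)
      also have "(\<Sum>j\<le>m. card A choose j) + (\<Sum>j\<le>m'. card A choose j)
        = (\<Sum>j\<le>m. Suc (card A) choose j)"
        unfolding Suc by (simp add: sum.atMost_Suc_shift sum.distrib del: sum.atMost_Suc)
      finally show ?thesis using cA by (simp add: G_def)
    qed
  qed
qed

text \<open>Comparison with the binomial distribution of parameter \<open>p = m / n\<close>. Since
  \<open>p \<le> 1 / 2\<close>, a fixed outcome with \<open>j \<le> m\<close> successes has
  probability at least \<open>p ^ m * (1 - p) ^ (n - m)\<close>, which is
  \<open>exp (- n * hb p)\<close>, and all probabilities sum to one.\<close>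

lemma sum_binomial_le_entropy:
  assumes "0 < n" "2 * m \<le> n"
  shows "real (\<Sum>j\<le>m. n choose j) \<le> exp (real n * hb (real m / real n))"
proof (cases "m = 0")
  case True
  then show ?thesis by (simp add: hb_def)
next
  case False
  define p where "p = real m / real n"
  have p: "0 < p" "p \<le> 1 / 2" "p < 1"
    using assms False by (auto simp: p_def field_simps)
  have np: "real n * p = m" using assms by (simp add: p_def)
  have e: "exp (- real n * hb p) = p ^ m * (1 - p) ^ (n - m)"
  proof -
    have "- real n * hb p = real m * ln p + real (n - m) * ln (1 - p)"
      using p assms np by (simp add: hb_def of_nat_diff algebra_simps) (simp add: mult.assoc[symmetric] np)
    then show ?thesis
      using p by (simp add: exp_add exp_of_nat_mult)
  qed
  have "(\<Sum>j\<le>m. real (n choose j)) * exp (- real n * hb p)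
    \<le> (\<Sum>j\<le>m. real (n choose j) * p ^ j * (1 - p) ^ (n - j))"
    unfolding e sum_distrib_right
  proof (rule sum_mono)
    fix j assume "j \<in> {..m}"
    then have j: "j \<le> m" "n - j = (m - j) + (n - m)" "m = j + (m - j)" using assms by auto
    have "p ^ m * (1 - p) ^ (n - m) = p ^ j * p ^ (m - j) * (1 - p) ^ (n - m)"
      using j(3) by (metis power_add)
    also have "\<dots> \<le> p ^ j * (1 - p) ^ (m - j) * (1 - p) ^ (n - m)"
      using p by (intro mult_right_mono mult_left_mono power_mono) auto
    also have "\<dots> = p ^ j * (1 - p) ^ (n - j)"
      unfolding j(2) by (simp add: power_add)
    finally show "real (n choose j) * (p ^ m * (1 - p) ^ (n - m))
      \<le> real (n choose j) * p ^ j * (1 - p) ^ (n - j)"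
      by (simp add: mult.assoc mult_left_mono)
  qed
  also have "\<dots> \<le> (\<Sum>j\<le>n. real (n choose j) * p ^ j * (1 - p) ^ (n - j))"
    using p assms by (intro sum_mono2) auto
  also have "\<dots> = 1"
    using binomial_ring[of p "1 - p" n] by simp
  finally show ?thesis
    by (simp add: exp_minus field_simps p_def)
qed

text \<open>A sequence is determined by its restrictions to the context classes, so the counts
  multiply over \<open>Cs\<close>. Each class is charged as if it had \<open>r\<close> positions:
  \<open>T\<close> will be a residue class, while the bound is wanted in terms of the full range of
  length \<open>n - 2 * k\<close>.\<close>

lemma card_contextwise_few_shifts:
  fixes C :: "nat \<Rightarrow> 'c"
  assumes T: "finite T" "card T \<le> r" and Cs: "finite Cs" "C ` T \<subseteq> Cs"
    and r: "0 < r" "2 * m \<le> r"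
  shows "real (card {\<sigma> \<in> T \<rightarrow>\<^sub>E (UNIV :: 'b::finite set). \<forall>c. card (shifts {t\<in>T. C t = c} \<sigma>) \<le> m})
    \<le> exp (real (card Cs) * (real r * hb (real m / real r) + real (m + 1) * ln (real CARD('b))))"
proof -
  let ?F = "{\<sigma> \<in> T \<rightarrow>\<^sub>E (UNIV :: 'b set). \<forall>c. card (shifts {t\<in>T. C t = c} \<sigma>) \<le> m}"
  let ?T = "\<lambda>c. {t\<in>T. C t = c}"
  let ?G = "\<lambda>c. {\<sigma> \<in> ?T c \<rightarrow>\<^sub>E (UNIV :: 'b set). card (shifts (?T c) \<sigma>) \<le> m}"
  define K where "K = exp (real r * hb (real m / real r) + real (m + 1) * ln (real CARD('b)))"
  have fT: "finite (?T c)" for c using T by simp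
  have finG: "finite (?G c)" for c
    by (rule finite_subset[OF _ finite_PiE[OF fT[of c], of "\<lambda>_. UNIV"]]) auto
  have "card ?F \<le> card (PiE Cs ?G)"
  proof (rule card_inj_on_le[where f = "\<lambda>\<sigma>. \<lambda>c\<in>Cs. restrict \<sigma> (?T c)"])
    show "inj_on (\<lambda>\<sigma>. \<lambda>c\<in>Cs. restrict \<sigma> (?T c)) ?F"
    proof (rule inj_onI)
      fix \<sigma> \<sigma>' :: "nat \<Rightarrow> 'b"
      assume s: "\<sigma> \<in> ?F" "\<sigma>' \<in> ?F"
        and e: "(\<lambda>c\<in>Cs. restrict \<sigma> (?T c)) = (\<lambda>c\<in>Cs. restrict \<sigma>' (?T c))"
      show "\<sigma> = \<sigma>'"
      proof (rule PiE_ext)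
        show "\<sigma> \<in> T \<rightarrow>\<^sub>E UNIV" "\<sigma>' \<in> T \<rightarrow>\<^sub>E UNIV" using s by auto
        fix t assume t: "t \<in> T"
        then have "C t \<in> Cs" using Cs by auto
        then have "restrict \<sigma> (?T (C t)) = restrict \<sigma>' (?T (C t))"
          using fun_cong[OF e, of "C t"] by simp
        from fun_cong[OF this, of t] show "\<sigma> t = \<sigma>' t" using t by simp
      qed
    qed
    have "shifts (?T c) (restrict \<sigma> (?T c)) = shifts (?T c) \<sigma>" for c and \<sigma> :: "nat \<Rightarrow> 'b"
      by (rule shifts_cong) simp
    then show "(\<lambda>\<sigma>. \<lambda>c\<in>Cs. restrict \<sigma> (?T c)) ` ?F \<subseteq> PiE Cs ?G"
      by (auto simp: PiE_iff extensional_def)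
    show "finite (PiE Cs ?G)" using Cs finG by (intro finite_PiE) auto
  qed
  also have "\<dots> = (\<Prod>c\<in>Cs. card (?G c))" using Cs by (simp add: card_PiE)
  finally have "real (card ?F) \<le> real (\<Prod>c\<in>Cs. card (?G c))" by (rule of_nat_mono)
  also have "\<dots> = (\<Prod>c\<in>Cs. real (card (?G c)))" by (rule of_nat_prod)
  also have "\<dots> \<le> (\<Prod>c\<in>Cs. K)"
  proof (intro prod_mono conjI)
    fix c
    have "card (?T c) \<le> card T" by (rule card_mono) (use T in auto)
    then have cr: "card (?T c) \<le> r" using T by simp
    have "card (?G c) \<le> CARD('b) ^ (m + 1) * (\<Sum>j\<le>m. card (?T c) choose j)"
      by (rule card_few_shifts[OF fT])
    also have "\<dots> \<le> CARD('b) ^ (m + 1) * (\<Sum>j\<le>m. r choose j)"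
      by (intro mult_left_mono sum_mono binomial_right_mono cr) simp
    finally have "real (card (?G c)) \<le> real (CARD('b) ^ (m + 1) * (\<Sum>j\<le>m. r choose j))"
      by (rule of_nat_mono)
    also have "\<dots> = real (CARD('b) ^ (m + 1)) * real (\<Sum>j\<le>m. r choose j)"
      by (rule of_nat_mult)
    also have "\<dots> \<le> real (CARD('b) ^ (m + 1)) * exp (real r * hb (real m / real r))"
      by (intro mult_left_mono sum_binomial_le_entropy r) simp
    also have "\<dots> = K"
    proof -
      have "exp (real (m + 1) * ln (real CARD('b))) = real CARD('b) ^ (m + 1)"
        unfolding exp_of_nat_mult by simp
      then show ?thesis unfolding K_def exp_add by (simp add: mult_ac)
    qed
    finally show "real (card (?G c)) \<le> K" .
  qed simp
  also have "\<dots> = exp (real (card Cs) * (real r * hb (real m / real r) + real (m + 1) * ln (real CARD('b))))"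
    by (simp add: K_def exp_of_nat_mult)
  finally show ?thesis .
qed

subsection \<open>Stationary processes and their block products\<close>

lemma cylinder_sets:
  assumes "is_process P"
  shows "{\<omega> \<in> space P. \<forall>i<n. \<omega> i = a i} \<in> sets P"
proof -
  have s: "sets P = sets seqM" using assms by (simp add: is_process_def)
  have sp: "space P = space seqM" by (rule sets_eq_imp_space_eq[OF s])
  have c: "(\<lambda>\<omega>. \<omega> i) \<in> measurable seqM (count_space UNIV)" for i
    unfolding seqM_def by (rule measurable_component_singleton) simp
  have "{\<omega> \<in> space seqM. \<omega> i = a i} \<in> sets seqM" for i
  proof -
    have "{\<omega> \<in> space seqM. \<omega> i = a i} = (\<lambda>\<omega>. \<omega> i) -` {a i} \<inter> space seqM" by blast
    then show ?thesis using measurable_sets[OF c[of i], of "{a i}"] by simp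
  qed
  then have "{\<omega> \<in> space seqM. \<forall>i\<in>{..<n}. \<omega> i = a i} \<in> sets seqM"
    by (rule sets.sets_Collect_finite_All) simp
  then show ?thesis unfolding s sp Ball_def lessThan_iff .
qed

lemma process_prob_space: "is_process P \<Longrightarrow> prob_space P"
  by (simp add: is_process_def)

lemma pfx_nonneg: "0 \<le> pfx P xs"
  by (simp add: pfx_def)

lemma pfx_Nil: "is_process P \<Longrightarrow> pfx P [] = 1"
  by (simp add: pfx_def process_prob_space prob_space.prob_space)

lemma sum_pfx_snoc:
  fixes P :: "(nat \<Rightarrow> 'x::finite) measure"
  assumes "is_process P"
  shows "(\<Sum>x\<in>UNIV. pfx P (xs @ [x])) = pfx P xs"
proof -
  interpret prob_space P by (rule process_prob_space[OF assms])
  let ?E = "\<lambda>ys. {\<omega> \<in> space P. \<forall>i<length ys. \<omega> i = ys ! i}"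
  have eq: "?E (xs @ [x]) = {\<omega> \<in> ?E xs. \<omega> (length xs) = x}" for x
    by (auto simp: nth_append less_Suc_eq)
  have "measure P (\<Union>x\<in>UNIV. ?E (xs @ [x])) = (\<Sum>x\<in>UNIV. measure P (?E (xs @ [x])))"
  proof (rule finite_measure_finite_Union)
    show "(\<lambda>x. ?E (xs @ [x])) ` UNIV \<subseteq> sets P"
      using cylinder_sets[OF assms] by blast
    show "disjoint_family_on (\<lambda>x. ?E (xs @ [x])) UNIV"
      unfolding eq by (auto simp: disjoint_family_on_def)
  qed simp
  moreover have "(\<Union>x\<in>UNIV. ?E (xs @ [x])) = ?E xs"
    unfolding eq by auto
  ultimately show ?thesis by (simp add: pfx_def)
qed

text \<open>Summing out the first symbol amounts to shifting the process by one. Shift invariance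
  enters the proof only through this identity.\<close>

lemma sum_pfx_Cons:
  fixes Q :: "(nat \<Rightarrow> 'x::finite) measure"
  assumes "is_stationary Q"
  shows "(\<Sum>x\<in>UNIV. pfx Q (x # xs)) = pfx Q xs"
proof -
  have pr: "is_process Q" and d: "distr Q seqM (\<lambda>\<omega> i. \<omega> (Suc i)) = Q"
    using assms by (auto simp: is_stationary_def)
  interpret prob_space Q by (rule process_prob_space[OF pr])
  let ?E = "\<lambda>ys. {\<omega> \<in> space Q. \<forall>i<length ys. \<omega> i = ys ! i}"
  have s: "sets Q = sets seqM" using pr by (simp add: is_process_def)
  have sp: "space Q = UNIV"
    using sets_eq_imp_space_eq[OF s] by (simp add: seqM_def space_PiM)
  have m: "(\<lambda>\<omega> i. \<omega> (Suc i)) \<in> measurable Q seqM"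
    unfolding measurable_cong_sets[OF s refl] unfolding seqM_def
    by (rule measurable_PiM_single') (auto simp: space_PiM intro!: measurable_component_singleton)
  have E: "?E ys \<in> sets Q" for ys
    by (rule cylinder_sets[OF pr])
  have "pfx Q xs = measure (distr Q seqM (\<lambda>\<omega> i. \<omega> (Suc i))) (?E xs)"
    by (simp add: d pfx_def)
  also have "\<dots> = measure Q {\<omega>. \<forall>i<length xs. \<omega> (Suc i) = xs ! i}"
    using E[of xs] by (subst measure_distr[OF m]) (auto simp: s sp intro!: arg_cong[where f = "measure Q"])
  also have "{\<omega>. \<forall>i<length xs. \<omega> (Suc i) = xs ! i} = (\<Union>x\<in>UNIV. ?E (x # xs))"
    by (auto simp: sp less_Suc_eq_0_disj)
  also have "measure Q (\<Union>x\<in>UNIV. ?E (x # xs)) = (\<Sum>x\<in>UNIV. measure Q (?E (x # xs)))"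
  proof (rule finite_measure_finite_Union)
    show "(\<lambda>x. ?E (x # xs)) ` UNIV \<subseteq> sets Q"
      using E by blast
    show "disjoint_family_on (\<lambda>x. ?E (x # xs)) UNIV"
      by (auto simp: disjoint_family_on_def)
  qed simp
  finally show ?thesis by (simp add: pfx_def)
qed

lemma sum_pfx_suffix:
  fixes P :: "(nat \<Rightarrow> 'x::finite) measure"
  assumes "is_process P"
  shows "(\<Sum>w\<in>words b. pfx P (v @ w)) = pfx P v"
proof (induction b)
  case (Suc b)
  have "(\<Sum>w\<in>words (b + Suc 0). pfx P (v @ w)) = (\<Sum>w\<in>words b. pfx P (v @ w))"
    unfolding sum_words_append
    using sum_pfx_snoc[OF assms, of "v @ _"] by (simp add: sum_words_1)
  then show ?case using Suc by simp
qed simp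

lemma sum_pfx_prefix:
  fixes Q :: "(nat \<Rightarrow> 'x::finite) measure"
  assumes "is_stationary Q"
  shows "(\<Sum>u\<in>words a. pfx Q (u @ v)) = pfx Q v"
proof (induction a)
  case (Suc a)
  have "(\<Sum>u\<in>words (Suc a). pfx Q (u @ v)) = (\<Sum>u\<in>words a. \<Sum>x\<in>UNIV. pfx Q (x # u @ v))"
    unfolding sum_words_Suc by (subst sum.swap) simp
  then show ?case using Suc by (simp add: sum_pfx_Cons[OF assms])
qed simp

lemma sum_pfx_words:
  fixes P :: "(nat \<Rightarrow> 'x::finite) measure"
  shows "is_process P \<Longrightarrow> (\<Sum>w\<in>words n. pfx P w) = 1"
  using sum_pfx_suffix[of P "[]" n] pfx_Nil[of P] by simp

lemma sum_pfx_margin: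
  fixes Q :: "(nat \<Rightarrow> 'x::finite) measure"
  assumes "is_stationary Q"
  shows "(\<Sum>u\<in>words a. \<Sum>w\<in>words b. pfx Q (u @ v @ w)) = pfx Q v"
proof -
  have "is_process Q" using assms by (simp add: is_stationary_def)
  then show ?thesis
    using sum_pfx_suffix[of Q "_ @ v"] by (simp add: sum_pfx_prefix[OF assms])
qed

text \<open>\<open>segp R s es xs\<close> is the weight of a string \<open>xs\<close> occupying the positions from \<open>s\<close> on, when
  \<open>es\<close> lists the ends of the successive blocks and \<open>R e\<close> is the law of the block that ends at \<open>e\<close>.\<close>

fun segp :: "(nat \<Rightarrow> (nat \<Rightarrow> 'x) measure) \<Rightarrow> nat \<Rightarrow> nat list \<Rightarrow> 'x list \<Rightarrow> real" where
  "segp R s [] xs = 1"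
| "segp R s (e # es) xs = pfx (R e) (take (e - s) xs) * segp R e es (drop (e - s) xs)"

lemma segp_nonneg: "0 \<le> segp R s es xs"
  by (induction es arbitrary: s xs) (auto simp: pfx_nonneg)

lemma le_last_sorted: "sorted (s # es) \<Longrightarrow> s \<le> last (s # es)"
  using last_in_set[of "s # es"] by (auto simp del: last.simps last_in_set)

lemma segp_append:
  assumes "sorted (s # es)" "length u = last (s # es) - s"
  shows "segp R s (es @ fs) (u @ v) = segp R s es u * segp R (last (s # es)) fs v"
  using assms
proof (induction es arbitrary: s u)
  case (Cons e es)
  have e: "s \<le> e" "e \<le> last (e # es)" using Cons.prems le_last_sorted[of e es] by auto
  have "segp R e (es @ fs) (drop (e - s) u @ v)
    = segp R e es (drop (e - s) u) * segp R (last (e # es)) fs v"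
    using Cons.prems e by (intro Cons.IH) auto
  then show ?case
    using Cons.prems e by (auto simp: take_append drop_append)
qed simp

lemma sum_segp:
  fixes R :: "nat \<Rightarrow> (nat \<Rightarrow> 'x::finite) measure"
  assumes "sorted (s # es)" "\<And>e. e \<in> set es \<Longrightarrow> is_process (R e)"
  shows "(\<Sum>xs\<in>words (last (s # es) - s). segp R s es xs) = 1"
  using assms
proof (induction es arbitrary: s)
  case (Cons e es)
  have e: "s \<le> e" "e \<le> last (e # es)" using Cons.prems le_last_sorted[of e es] by auto
  then have l: "last (s # e # es) - s = (e - s) + (last (e # es) - e)" by simp
  have IH: "(\<Sum>xs\<in>words (last (e # es) - e). segp R e es xs) = 1"
    using Cons.prems by (intro Cons.IH) auto
  have "(\<Sum>xs\<in>words (last (s # e # es) - s). segp R s (e # es) xs)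
    = (\<Sum>u\<in>words (e - s). \<Sum>v\<in>words (last (e # es) - e). pfx (R e) u * segp R e es v)"
    unfolding l sum_words_append by (intro sum.cong refl) simp
  also have "\<dots> = (\<Sum>u\<in>words (e - s). pfx (R e) u)"
    unfolding sum_distrib_left[symmetric] IH by simp
  also have "\<dots> = 1" using Cons.prems by (intro sum_pfx_words) simp
  finally show ?case .
qed simp

text \<open>\<open>block_prod\<close> cuts each block out of the whole string, whereas
  \<open>segp\<close> consumes the string from the left; dropping \<open>s\<close> symbols aligns
  the two.\<close>

lemma segp_eq_prod:
  assumes "sorted (s # es)"
  shows "(\<Prod>i<length es. pfx (R (es ! i)) (take (es ! i - (s # es) ! i) (drop ((s # es) ! i) ys)))
    = segp R s es (drop s ys)"
  using assms
proof (induction es arbitrary: s)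
  case (Cons e es)
  have "s \<le> e" using Cons.prems by simp
  then have d: "drop (e - s) (drop s ys) = drop e ys" by simp
  show ?case
    using Cons.IH[of e] Cons.prems d
    by (simp add: prod.lessThan_Suc_shift del: prod.lessThan_Suc)
qed simp

text \<open>Blocks are independent, so the weight factorizes at the two block ends around
  \<open>t\<close>. That \<open>s\<close> and \<open>e\<close> are switches or ends of the string is
  recorded because it later turns "far from every switch" into "window inside the block".\<close>

lemma block_prod_factor:
  fixes Q :: "nat \<Rightarrow> (nat \<Rightarrow> 'x::finite) measure"
  assumes t: "t < n" "length as = n" and Q: "\<And>a. a \<in> set as \<Longrightarrow> is_process (Q a)"
  obtains s e F G where "s \<le> t" "t < e" "e \<le> n"
    "s = 0 \<or> as ! (s - 1) \<noteq> as ! s" "e = n \<or> as ! (e - 1) \<noteq> as ! e"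
    "\<And>u. 0 \<le> F u" "\<And>w. 0 \<le> G w"
    "(\<Sum>u\<in>words s. F u) = 1" "(\<Sum>w\<in>words (n - e). G w) = 1"
    "\<And>u v w. length u = s \<Longrightarrow> length v = e - s \<Longrightarrow>
       block_prod Q as (u @ v @ w) = F u * pfx (Q (as ! t)) v * G w"
proof -
  define B where "B = {t. 0 < t \<and> t \<le> length as \<and> (t = length as \<or> as ! (t - 1) \<noteq> as ! t)}"
  define R where "R = (\<lambda>e. Q (as ! (e - 1)))"
  have finB: "finite B" by (rule finite_subset[of _ "{..n}"]) (auto simp: B_def t)
  have be: "block_ends as = sorted_list_of_set B" by (simp add: block_ends_def B_def)
  have nB: "n \<in> B" using t by (auto simp: B_def)
  \<comment> \<open>Block ends are exclusive, so the block of \<open>t\<close> ends at the first end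
    strictly beyond \<open>t\<close>.\<close>
  define e where "e = (LEAST e. e \<in> B \<and> t < e)"
  have e: "e \<in> B" "t < e"
    using LeastI[of "\<lambda>e. e \<in> B \<and> t < e" n] nB t by (auto simp: e_def)
  have eleast: "e \<le> b" if "b \<in> B" "t < b" for b
    unfolding e_def using that by (intro Least_le) auto
  obtain es fs where \<tau>: "block_ends as = es @ e # fs"
    using e finB split_list[of e "block_ends as"] by (auto simp: be)
  have setB: "B = set es \<union> {e} \<union> set fs"
    using \<tau> finB by (metis Un_insert_right be list.set(2) set_append set_sorted_list_of_set
        sup_bot.right_neutral sup_assoc insert_is_Un)
  have srt: "sorted_wrt (<) (es @ e # fs)"
    using \<tau> be by (metis strict_sorted_list_of_set)
  then have sorted: "sorted (es @ e # fs)" by (rule strict_sorted_imp_sorted)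
  have es: "x \<le> t" if "x \<in> set es" for x
  proof -
    have "x < e" using srt that by (auto simp: sorted_wrt_append)
    then show ?thesis using eleast[of x] that setB by force
  qed
  \<comment> \<open>Prepending \<open>0\<close> covers the case that \<open>t\<close> lies in the
    first block and \<open>es\<close> is empty.\<close>
  define s where "s = last (0 # es)"
  have sin: "s = 0 \<or> s \<in> set es" by (auto simp: s_def)
  have st: "s \<le> t" using sin es by auto
  have fs: "e < x" if "x \<in> set fs" for x
    using srt that by (auto simp: sorted_wrt_append)
  have es_s: "x \<le> s" if "x \<in> set es" for x
  proof -
    have "sorted es" using sorted by (simp add: sorted_append)
    then show ?thesis unfolding s_def using that
      by (induction es rule: rev_induct) (auto simp: sorted_append)
  qed
  have en: "e \<le> n" using e by (auto simp: B_def t)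
  \<comment> \<open>Without a block end strictly between \<open>s\<close> and \<open>e\<close> the
    regime is constant there, so the law \<open>R e\<close>, which reads the regime at
    \<open>e - 1\<close>, is the one at \<open>t\<close>.\<close>
  have nob: "as ! (j - 1) = as ! j" if "s < j" "j < e" for j
  proof (rule ccontr)
    assume "as ! (j - 1) \<noteq> as ! j"
    then have "j \<in> B" using that en t by (auto simp: B_def)
    then show False using that es_s[of j] fs[of j] setB by auto
  qed
  have const_s: "as ! j = as ! s" if "s \<le> j" "j < e" for j
    using that
  proof (induction j rule: dec_induct)
    case (step j)
    then show ?case using nob[of "Suc j"] by simp
  qed simp
  have const: "as ! j = as ! t" if "s \<le> j" "j < e" for j
    using const_s[OF that] const_s[OF st e(2)] by simp
  have last_fs: "last (e # fs) = n"
  proof -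
    have "last (e # fs) \<in> B" using setB by (auto intro: last_in_set)
    then have "last (e # fs) \<le> n" by (auto simp: B_def t)
    moreover have "n \<le> last (e # fs)"
    proof -
      have "n \<in> set (e # fs)" using nB setB es t by force
      moreover have "sorted (e # fs)" using sorted by (simp add: sorted_append)
      ultimately show ?thesis
        by (induction fs arbitrary: e) (auto dest: le_last_sorted)
    qed
    ultimately show ?thesis by simp
  qed
  have R: "is_process (R x)" if "x \<in> B" for x
    using that Q t by (auto simp: R_def B_def)
  have sorted_e: "sorted (0 # es)" "sorted (e # fs)" "sorted (0 # es @ e # fs)"
    using sorted by (auto simp: sorted_append)
  show ?thesis
  proof (rule that[of s e "segp R 0 es" "segp R e fs"])
    show "s = 0 \<or> as ! (s - 1) \<noteq> as ! s"
    proof -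
      have "s = 0 \<or> s \<in> B" using sin setB by blast
      then show ?thesis using st t by (auto simp: B_def)
    qed
    show "e = n \<or> as ! (e - 1) \<noteq> as ! e"
      using e t by (auto simp: B_def)
    show "(\<Sum>u\<in>words s. segp R 0 es u) = 1"
      using sum_segp[OF sorted_e(1), of R] R setB by (simp add: s_def)
    show "(\<Sum>w\<in>words (n - e). segp R e fs w) = 1"
      using sum_segp[OF sorted_e(2), of R] R setB last_fs by simp
    fix u v w :: "'x list"
    assume uv: "length u = s" "length v = e - s"
    have "block_prod Q as (u @ v @ w) = segp R 0 (es @ e # fs) (u @ v @ w)"
      using segp_eq_prod[OF sorted_e(3), of R "u @ v @ w"]
      by (simp only: block_prod_def \<tau> Let_def R_def drop0)
    also have "\<dots> = segp R 0 es u * segp R s (e # fs) (v @ w)"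
    proof -
      have "length u = last (0 # es) - 0" using uv by (simp only: s_def diff_zero)
      from segp_append[OF sorted_e(1) this, of R "e # fs" "v @ w"] show ?thesis unfolding s_def .
    qed
    also have "segp R s (e # fs) (v @ w) = pfx (R e) v * segp R e fs w"
      using uv by simp
    also have "R e = Q (as ! t)"
      using const[of "e - 1"] st e by (simp add: R_def)
    finally show "block_prod Q as (u @ v @ w) = segp R 0 es u * pfx (Q (as ! t)) v * segp R e fs w"
      by simp
  qed (fact st e en segp_nonneg)+
qed

subsection \<open>Uniform deviation of the estimated loss\<close>

text \<open>The context of \<open>t\<close> omits \<open>t\<close> itself and reaches
  \<open>k\<close> positions to either side. The condition \<open>k \<le> t\<close> keeps
  \<open>t - k\<close> exact; truncated subtraction would move the left part onto
  \<open>t\<close>.\<close>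

lemma ctx_update:
  assumes "k \<le> t" "t' + k < t \<or> t' = t \<or> t + k < t'"
  shows "ctx k (zs[t' := z]) t = ctx k zs t"
proof -
  have "take k (drop a (zs[t' := z])) = take k (drop a zs)" if "t' < a \<or> a + k \<le> t'" for a
    by (rule nth_equalityI) (use that in \<open>auto simp: nth_list_update\<close>)
  note same = this
  have "take k (drop (t - k) (zs[t' := z])) = take k (drop (t - k) zs)"
    by (rule same) (use assms in auto)
  moreover have "take k (drop (Suc t) (zs[t' := z])) = take k (drop (Suc t) zs)"
    by (rule same) (use assms in auto)
  ultimately show ?thesis by (simp add: ctx_def)
qed

lemma Skm_iff: "\<sigma> \<in> Skm k m zs \<longleftrightarrow> (\<forall>c. card (shifts (Tset k zs c) \<sigma>) \<le> m)"
  by (simp add: Skm_def shifts_def)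

text \<open>Two positions in the same residue class modulo \<open>k + 1\<close> do not lie in each other's context
  window. Hence on such a class the set of admissible rule sequences is independent of the observed
  symbols, and a union bound over this set is possible.\<close>

lemma deviation_residue_class:
  fixes f :: "'x::finite \<Rightarrow> 'z::finite \<Rightarrow> ('z \<Rightarrow> 'xh::finite) \<Rightarrow> real"
  assumes st: "stochastic Ch" and n: "length xs = n" and k: "2 * k < n" and m: "m \<le> (n - 2 * k) div 2"
    and mean: "\<And>x s. (\<Sum>z\<in>UNIV. Ch x z * f x z s) = 0" and M: "\<And>x z s. \<bar>f x z s\<bar> \<le> M"
    and l: "0 < l" "l * M \<le> 1"
    and \<sigma>: "\<And>zs. length zs = n \<Longrightarrow> \<sigma> zs \<in> Skm k m zs"
    and T: "T = {t \<in> {k..<n - k}. t mod (k + 1) = d}"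
  shows "(\<Sum>zs\<in>words n. chn Ch xs zs * (\<Sum>t\<in>T. f (xs ! t) (zs ! t) (\<sigma> zs t)))
    \<le> real CARD('z) ^ (2 * k) * (real (n - 2 * k) * hb (real m / real (n - 2 * k))
          + real (m + 1) * ln (real CARD('z \<Rightarrow> 'xh))) / l + l * M\<^sup>2 * real (card T)"
proof -
  let ?r = "n - 2 * k"
  define lnK where "lnK = real CARD('z) ^ (2 * k) * (real ?r * hb (real m / real ?r)
          + real (m + 1) * ln (real CARD('z \<Rightarrow> 'xh)))"
  define U where "U = T \<rightarrow>\<^sub>E (UNIV :: ('z \<Rightarrow> 'xh) set)"
  \<comment> \<open>Constraining the sequences only along the context classes within
    \<open>T\<close> makes \<open>Fam zs\<close> a function of the contexts at \<open>T\<close>.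
    Hence it does not change with the symbols on \<open>T\<close>.\<close>
  define Fam where "Fam = (\<lambda>zs :: 'z list. {\<tau> \<in> U. \<forall>c. card (shifts {t\<in>T. ctx k zs t = c} \<tau>) \<le> m})"
  define S where "S = (\<lambda>zs \<tau>. \<Sum>t\<in>T. f (xs ! t) (zs ! t) (\<tau> t))"
  define b where "b = exp (l\<^sup>2 * M\<^sup>2)"
  define c where "c = lnK + l\<^sup>2 * M\<^sup>2 * real (card T)"
  have finT: "finite T" by (simp add: T)
  have Tn: "T \<subseteq> {..<n}" by (auto simp: T)
  have finU: "finite U" unfolding U_def by (intro finite_PiE finT) simp
  have cT: "card T \<le> ?r"
  proof -
    have "card T \<le> card {k..<n - k}" by (rule card_mono) (auto simp: T)
    then show ?thesis by simp
  qed
  have famcard: "real (card (Fam zs)) \<le> exp lnK" if "length zs = n" for zs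
  proof -
    have "real (card (Fam zs)) \<le> exp (real (card (words k \<times> words k :: ('z list \<times> 'z list) set)) *
       (real ?r * hb (real m / real ?r) + real (m + 1) * ln (real CARD('z \<Rightarrow> 'xh))))"
      unfolding Fam_def U_def
    proof (rule card_contextwise_few_shifts[OF finT cT])
      show "ctx k zs ` T \<subseteq> words k \<times> words k"
        using that by (auto simp: ctx_def T)
    qed (use k m in auto)
    also have "real (card (words k \<times> words k :: ('z list \<times> 'z list) set)) = real CARD('z) ^ (2 * k)"
      by (simp add: card_cartesian_product card_words mult_2 power_add)
    finally show ?thesis by (simp add: lnK_def)
  qed
  have sep: "t' + k < t \<or> t' = t \<or> t + k < t'" if "t \<in> T" "t' \<in> T" for t t'
  proof (rule ccontr)
    assume "\<not> ?thesis"
    then have ne: "t' \<noteq> t" and d: "t < t' + (k + 1)" "t' < t + (k + 1)" by auto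
    have "t mod (k + 1) = t' mod (k + 1)" using that by (simp add: T)
    then obtain q where "t' = t + (k + 1) * q \<or> t = t' + (k + 1) * q"
      by (metis mod_eq_nat1E mod_eq_nat2E nat_le_linear)
    then show False using d ne by (cases q) auto
  qed
  have faminv: "Fam (zs[t' := z]) = Fam zs" if "t' \<in> T" for zs t' z
  proof -
    have "{t\<in>T. ctx k (zs[t' := z]) t = c} = {t\<in>T. ctx k zs t = c}" for c
    proof (rule Collect_cong, rule conj_cong[OF refl])
      fix t assume "t \<in> T"
      then have "ctx k (zs[t' := z]) t = ctx k zs t"
        by (intro ctx_update sep that) (auto simp: T)
      then show "(ctx k (zs[t' := z]) t = c) = (ctx k zs t = c)" by simp
    qed
    then show ?thesis by (simp add: Fam_def)
  qed
  \<comment> \<open>Passing from a context class to its part in \<open>T\<close> cannot increase the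
    number of shifts.\<close>
  have mem: "restrict (\<sigma> zs) T \<in> Fam zs" if zs: "length zs = n" for zs
  proof -
    have "card (shifts {t\<in>T. ctx k zs t = c} (restrict (\<sigma> zs) T)) \<le> m" for c
    proof -
      have "shifts {t\<in>T. ctx k zs t = c} (restrict (\<sigma> zs) T) = shifts {t\<in>T. ctx k zs t = c} (\<sigma> zs)"
        by (rule shifts_cong) simp
      also have "card \<dots> \<le> card (shifts (Tset k zs c) (\<sigma> zs))"
        by (rule card_shifts_mono) (auto simp: Tset_def T zs)
      also have "\<dots> \<le> m" using \<sigma>[OF zs] unfolding Skm_iff by (rule spec)
      finally show ?thesis .
    qed
    moreover have "restrict (\<sigma> zs) T \<in> U" by (simp add: U_def)
    ultimately show ?thesis unfolding Fam_def by blast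
  qed
  \<comment> \<open>The selected sequence depends on the symbols on \<open>T\<close>. Replacing its
    exponential by the sum over all of \<open>Fam zs\<close> removes this dependence, as in a union
    bound; then the coordinates in \<open>T\<close> integrate out and the indicators add up to the
    size of \<open>Fam zs\<close>.\<close>
  have mgf: "(\<Sum>zs\<in>words n. chn Ch xs zs * exp (l * S zs (\<sigma> zs))) \<le> exp c"
  proof -
    have "(\<Sum>zs\<in>words n. chn Ch xs zs * exp (l * S zs (\<sigma> zs))) \<le>
      (\<Sum>zs\<in>words n. chn Ch xs zs * (\<Sum>\<tau>\<in>U. indicator (Fam zs) \<tau> * exp (l * S zs \<tau>)))"
    proof (intro sum_mono mult_left_mono chn_nonneg st)
      fix zs :: "'z list" assume "zs \<in> words n"
      then have mem': "restrict (\<sigma> zs) T \<in> Fam zs" using mem by simp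
      have "exp (l * S zs (\<sigma> zs)) = indicator (Fam zs) (restrict (\<sigma> zs) T) * exp (l * S zs (restrict (\<sigma> zs) T))"
        using mem' by (simp add: S_def)
      also have "\<dots> \<le> (\<Sum>\<tau>\<in>U. indicator (Fam zs) \<tau> * exp (l * S zs \<tau>))"
        by (rule member_le_sum[of _ U "\<lambda>\<tau>. indicator (Fam zs) \<tau> * exp (l * S zs \<tau>)"])
          (use finU mem' in \<open>auto simp: Fam_def\<close>)
      finally show "exp (l * S zs (\<sigma> zs)) \<le> (\<Sum>\<tau>\<in>U. indicator (Fam zs) \<tau> * exp (l * S zs \<tau>))" .
    qed
    also have "\<dots> = (\<Sum>\<tau>\<in>U. \<Sum>zs\<in>words n. chn Ch xs zs * (indicator (Fam zs) \<tau> * exp (l * S zs \<tau>)))"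
      unfolding sum_distrib_left by (rule sum.swap)
    also have "\<dots> \<le> (\<Sum>\<tau>\<in>U. b ^ card T * (\<Sum>zs\<in>words n. chn Ch xs zs * indicator (Fam zs) \<tau>))"
    proof (rule sum_mono)
      fix \<tau>
      have "exp (l * S zs \<tau>) = (\<Prod>t\<in>T. exp (l * f (xs ! t) (zs ! t) (\<tau> t)))" for zs
        by (simp add: S_def sum_distrib_left exp_sum[OF finT])
      then have "(\<Sum>zs\<in>words n. chn Ch xs zs * (indicator (Fam zs) \<tau> * exp (l * S zs \<tau>)))
        = (\<Sum>zs\<in>words n. chn Ch xs zs * (indicator (Fam zs) \<tau> * (\<Prod>t\<in>T. exp (l * f (xs ! t) (zs ! t) (\<tau> t)))))"
        by simp
      also have "\<dots> \<le> b ^ card T * (\<Sum>zs\<in>words n. chn Ch xs zs * indicator (Fam zs) \<tau>)"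
      proof (rule chn_prod_bound[OF st n finT Tn])
        fix t assume "t \<in> T"
        show "(\<Sum>z\<in>UNIV. Ch (xs ! t) z * exp (l * f (xs ! t) z (\<tau> t))) \<le> b"
          unfolding b_def by (rule mgf_bound) (use st mean M l in \<open>auto simp: stochastic_def\<close>)
      qed (auto simp: b_def faminv)
      finally show "(\<Sum>zs\<in>words n. chn Ch xs zs * (indicator (Fam zs) \<tau> * exp (l * S zs \<tau>)))
        \<le> b ^ card T * (\<Sum>zs\<in>words n. chn Ch xs zs * indicator (Fam zs) \<tau>)" .
    qed
    also have "\<dots> = b ^ card T * (\<Sum>\<tau>\<in>U. \<Sum>zs\<in>words n. chn Ch xs zs * indicator (Fam zs) \<tau>)"
      by (rule sum_distrib_left[symmetric])
    also have "(\<Sum>\<tau>\<in>U. \<Sum>zs\<in>words n. chn Ch xs zs * indicator (Fam zs) \<tau>) =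
      (\<Sum>zs\<in>words n. chn Ch xs zs * (\<Sum>\<tau>\<in>U. indicator (Fam zs) \<tau>))"
      unfolding sum_distrib_left by (rule sum.swap)
    also have "b ^ card T * \<dots> = b ^ card T * (\<Sum>zs\<in>words n. chn Ch xs zs * real (card (Fam zs)))"
    proof -
      have "(\<Sum>\<tau>\<in>U. indicator (Fam zs) \<tau>) = real (card (Fam zs))" for zs
      proof -
        have "U \<inter> Fam zs = Fam zs" by (auto simp: Fam_def)
        then show ?thesis using finU by (simp add: sum.If_cases indicator_def of_bool_def)
      qed
      then show ?thesis by simp
    qed
    also have "\<dots> \<le> b ^ card T * (\<Sum>zs\<in>words n. chn Ch xs zs * exp lnK)"
      by (intro mult_left_mono sum_mono chn_nonneg st famcard) (auto simp: b_def)
    also have "\<dots> = b ^ card T * exp lnK"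
      by (simp add: sum_chn[OF st n] flip: sum_distrib_right)
    also have "\<dots> = exp c"
      by (simp add: c_def b_def exp_add exp_of_nat_mult[symmetric] mult_ac)
    finally show ?thesis .
  qed
  \<comment> \<open>Bounding \<open>l * S\<close> by the tangent inequality for \<open>exp\<close> at \<open>c\<close> takes the place of Jensen's inequality.\<close>
  have "l * (\<Sum>zs\<in>words n. chn Ch xs zs * S zs (\<sigma> zs)) = (\<Sum>zs\<in>words n. chn Ch xs zs * (l * S zs (\<sigma> zs)))"
    by (simp add: sum_distrib_left mult_ac)
  also have "\<dots> \<le> (\<Sum>zs\<in>words n. chn Ch xs zs * (c - 1 + exp (- c) * exp (l * S zs (\<sigma> zs))))"
  proof (intro sum_mono mult_left_mono chn_nonneg st)
    fix zs
    show "l * S zs (\<sigma> zs) \<le> c - 1 + exp (- c) * exp (l * S zs (\<sigma> zs))"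
      using exp_ge_add_one_self[of "l * S zs (\<sigma> zs) - c"] by (simp add: exp_diff exp_minus divide_inverse mult_ac)
  qed
  also have "\<dots> = (\<Sum>zs\<in>words n. chn Ch xs zs) * (c - 1)
     + exp (- c) * (\<Sum>zs\<in>words n. chn Ch xs zs * exp (l * S zs (\<sigma> zs)))"
    unfolding sum_distrib_left sum_distrib_right sum.distrib[symmetric]
    by (intro sum.cong) (auto simp: algebra_simps)
  also have "\<dots> \<le> 1 * (c - 1) + exp (- c) * exp c"
    unfolding sum_chn[OF st n] by (intro add_left_mono mult_left_mono mgf) simp
  also have "\<dots> = c" by (simp flip: exp_add)
  finally have "(\<Sum>zs\<in>words n. chn Ch xs zs * S zs (\<sigma> zs)) \<le> c / l"
    using l by (simp add: field_simps)
  also have "c / l = lnK / l + l * M\<^sup>2 * real (card T)"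
    using l by (simp add: c_def field_simps power2_eq_square)
  finally show ?thesis by (simp add: S_def lnK_def)
qed

text \<open>Each of the \<open>k + 1\<close> residue classes pays the full logarithmic count, while
  the second-order terms add up to a single one for the whole range. Hence \<open>k + 1\<close>
  multiplies the first term only.\<close>

lemma deviation:
  fixes f :: "'x::finite \<Rightarrow> 'z::finite \<Rightarrow> ('z \<Rightarrow> 'xh::finite) \<Rightarrow> real"
  assumes st: "stochastic Ch" and n: "length xs = n" and k: "2 * k < n" and m: "m \<le> (n - 2 * k) div 2"
    and mean: "\<And>x s. (\<Sum>z\<in>UNIV. Ch x z * f x z s) = 0" and M: "\<And>x z s. \<bar>f x z s\<bar> \<le> M"
    and l: "0 < l" "l * M \<le> 1"
    and \<sigma>: "\<And>zs. length zs = n \<Longrightarrow> \<sigma> zs \<in> Skm k m zs"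
  shows "(\<Sum>zs\<in>words n. chn Ch xs zs * (\<Sum>t\<in>{k..<n - k}. f (xs ! t) (zs ! t) (\<sigma> zs t)))
    \<le> real (k + 1) * (real CARD('z) ^ (2 * k) * (real (n - 2 * k) * hb (real m / real (n - 2 * k))
          + real (m + 1) * ln (real CARD('z \<Rightarrow> 'xh)))) / l + l * M\<^sup>2 * real (n - 2 * k)"
proof -
  let ?L = "real CARD('z) ^ (2 * k) * (real (n - 2 * k) * hb (real m / real (n - 2 * k))
          + real (m + 1) * ln (real CARD('z \<Rightarrow> 'xh)))"
  let ?T = "\<lambda>d. {t \<in> {k..<n - k}. t mod (k + 1) = d}"
  have grp: "(\<Sum>t\<in>{k..<n - k}. g t) = (\<Sum>d<k + 1. \<Sum>t\<in>?T d. g t)" for g :: "nat \<Rightarrow> real"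
    by (rule sum.group[symmetric]) auto
  have "(\<Sum>d<k + 1. real (card (?T d))) = (\<Sum>t\<in>{k..<n - k}. 1)"
    unfolding grp[of "\<lambda>_. 1"] by (simp only: sum_constant mult.right_neutral)
  also have "\<dots> = real (n - 2 * k)" by (simp add: mult_2)
  finally have cards: "(\<Sum>d<k + 1. real (card (?T d))) = real (n - 2 * k)" .
  have "(\<Sum>zs\<in>words n. chn Ch xs zs * (\<Sum>t\<in>{k..<n - k}. f (xs ! t) (zs ! t) (\<sigma> zs t)))
    = (\<Sum>d<k + 1. \<Sum>zs\<in>words n. chn Ch xs zs * (\<Sum>t\<in>?T d. f (xs ! t) (zs ! t) (\<sigma> zs t)))"
    unfolding grp sum_distrib_left by (rule sum.swap)
  also have "\<dots> \<le> (\<Sum>d<k + 1. ?L / l + l * M\<^sup>2 * real (card (?T d)))"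
    by (intro sum_mono deviation_residue_class[OF st n k m mean M l \<sigma> refl])
  also have "\<dots> = real (k + 1) * (?L / l) + l * M\<^sup>2 * (\<Sum>d<k + 1. real (card (?T d)))"
    unfolding sum.distrib sum_distrib_left[symmetric] by simp
  also have "\<dots> = real (k + 1) * ?L / l + l * M\<^sup>2 * real (n - 2 * k)"
    unfolding cards by simp
  finally show ?thesis .
qed

text \<open>Averaging the rows of \<open>H\<close> over the output of \<open>x\<close> yields row
  \<open>x\<close> of the identity matrix. This singles out \<open>rho\<close> at \<open>x\<close>,
  the expected loss of \<open>s\<close> given \<open>x\<close>.\<close>

lemma ell_unbiased:
  assumes H: "right_inverse Ch H"
  shows "(\<Sum>z\<in>UNIV. Ch x z * (\<Lambda> x (s z) - ell Ch H \<Lambda> z s)) = 0"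
proof -
  have "(\<Sum>z\<in>UNIV. Ch x z * ell Ch H \<Lambda> z s) = (\<Sum>x'\<in>UNIV. (\<Sum>z\<in>UNIV. Ch x z * H z x') * rho Ch \<Lambda> x' s)"
    unfolding ell_def sum_distrib_left sum_distrib_right
    by (subst sum.swap) (simp add: mult.assoc)
  also have "\<dots> = (\<Sum>x'\<in>UNIV. if x = x' then rho Ch \<Lambda> x' s else 0)"
    using H by (intro sum.cong) (auto simp: right_inverse_def)
  also have "\<dots> = (\<Sum>z\<in>UNIV. Ch x z * \<Lambda> x (s z))"
    by (simp add: rho_def mult.commute)
  finally show ?thesis by (simp add: right_diff_distrib sum_subtractf)
qed

text \<open>The deviation bound leads from the true loss of the S-DUDE to its estimate, minimality
  leads to the estimate for \<open>\<gamma>\<close>, and unbiasedness leads back to a true loss. The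
  last passage is an equality, because the rule of \<open>\<gamma>\<close> at time \<open>t\<close>
  is blind to the symbol at \<open>t\<close>.\<close>

lemma sdude_vs_genie:
  fixes \<Lambda> :: "'x::finite \<Rightarrow> 'xh::finite \<Rightarrow> real" and Ch :: "'x \<Rightarrow> 'z::finite \<Rightarrow> real"
  assumes st: "stochastic Ch" and H: "right_inverse Ch H"
    and n: "length xs = n" and k: "2 * k < n" and m: "m \<le> (n - 2 * k) div 2"
    and M: "\<And>x z s. \<bar>\<Lambda> x (s z) - ell Ch H \<Lambda> z s\<bar> \<le> M"
    and l: "0 < l" "l * M \<le> 1"
    and D: "is_sdude Ch H \<Lambda> k m n D"
    and \<gamma>: "\<And>zs. length zs = n \<Longrightarrow> \<gamma> zs \<in> Skm k m zs"
      "\<And>zs t z. k \<le> t \<Longrightarrow> t < n - k \<Longrightarrow> \<gamma> (zs[t := z]) t = \<gamma> zs t"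
  shows "(\<Sum>zs\<in>words n. chn Ch xs zs * (\<Sum>t\<in>{k..<n - k}. \<Lambda> (xs ! t) (D zs t)))
    \<le> (\<Sum>zs\<in>words n. chn Ch xs zs * (\<Sum>t\<in>{k..<n - k}. \<Lambda> (xs ! t) (\<gamma> zs t (zs ! t))))
      + (real (k + 1) * (real CARD('z) ^ (2 * k) * (real (n - 2 * k) * hb (real m / real (n - 2 * k))
          + real (m + 1) * ln (real CARD('z \<Rightarrow> 'xh)))) / l + l * M\<^sup>2 * real (n - 2 * k))"
    (is "?lhs \<le> ?genie + ?dev")
proof -
  let ?I = "{k..<n - k}" and ?ell = "ell Ch H \<Lambda>"
  let ?f = "\<lambda>x z s. \<Lambda> x (s z) - ell Ch H \<Lambda> z s"
  obtain \<sigma> where \<sigma>: "\<And>zs. length zs = n \<Longrightarrow> \<sigma> zs \<in> Skm k m zs"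
    "\<And>zs \<sigma>'. length zs = n \<Longrightarrow> \<sigma>' \<in> Skm k m zs \<Longrightarrow>
       sdude_cost Ch H \<Lambda> k zs (\<sigma> zs) \<le> sdude_cost Ch H \<Lambda> k zs \<sigma>'"
    "\<And>zs t. length zs = n \<Longrightarrow> t \<in> ?I \<Longrightarrow> D zs t = \<sigma> zs t (zs ! t)"
  proof -
    obtain x0 where "\<forall>zs. length zs = n \<longrightarrow>
     (\<exists>\<sigma>\<in>Skm k m zs. (\<forall>\<sigma>'\<in>Skm k m zs. sdude_cost Ch H \<Lambda> k zs \<sigma> \<le> sdude_cost Ch H \<Lambda> k zs \<sigma>') \<and>
        (\<forall>t<n. D zs t = (if k \<le> t \<and> t < n - k then \<sigma> t (zs ! t) else x0)))"
      using D unfolding is_sdude_def by blast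
    then obtain \<sigma> where *: "\<And>zs. length zs = n \<Longrightarrow> \<sigma> zs \<in> Skm k m zs \<and>
      (\<forall>\<sigma>'\<in>Skm k m zs. sdude_cost Ch H \<Lambda> k zs (\<sigma> zs) \<le> sdude_cost Ch H \<Lambda> k zs \<sigma>') \<and>
        (\<forall>t<n. D zs t = (if k \<le> t \<and> t < n - k then \<sigma> zs t (zs ! t) else x0))"
      unfolding Bex_def by metis
    show ?thesis
      by (rule that[of \<sigma>]) (use * in auto)
  qed
  have cost: "(\<Sum>t\<in>?I. ?ell (zs ! t) (\<sigma> zs t)) \<le> (\<Sum>t\<in>?I. ?ell (zs ! t) (\<gamma> zs t))"
    if "length zs = n" for zs
    using \<sigma>(2)[OF that \<gamma>(1)[OF that]] that k by (simp add: sdude_cost_def divide_le_cancel)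
  have "?lhs = (\<Sum>zs\<in>words n. chn Ch xs zs * (\<Sum>t\<in>?I. ?f (xs ! t) (zs ! t) (\<sigma> zs t)))
      + (\<Sum>zs\<in>words n. chn Ch xs zs * (\<Sum>t\<in>?I. ?ell (zs ! t) (\<sigma> zs t)))"
    unfolding sum.distrib[symmetric] distrib_left[symmetric]
    by (intro sum.cong arg_cong2[where f = "(*)"]) (auto simp: \<sigma>(3))
  also have "\<dots> \<le> ?dev + (\<Sum>zs\<in>words n. chn Ch xs zs * (\<Sum>t\<in>?I. ?ell (zs ! t) (\<gamma> zs t)))"
  proof (rule add_mono)
    show "(\<Sum>zs\<in>words n. chn Ch xs zs * (\<Sum>t\<in>?I. ?f (xs ! t) (zs ! t) (\<sigma> zs t))) \<le> ?dev"
      by (rule deviation[OF st n k m]) (use ell_unbiased[OF H] M l \<sigma> in auto)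
    show "(\<Sum>zs\<in>words n. chn Ch xs zs * (\<Sum>t\<in>?I. ?ell (zs ! t) (\<sigma> zs t)))
      \<le> (\<Sum>zs\<in>words n. chn Ch xs zs * (\<Sum>t\<in>?I. ?ell (zs ! t) (\<gamma> zs t)))"
      by (intro sum_mono mult_left_mono chn_nonneg st cost) auto
  qed
  also have "(\<Sum>zs\<in>words n. chn Ch xs zs * (\<Sum>t\<in>?I. ?ell (zs ! t) (\<gamma> zs t))) = ?genie"
  proof -
    have z: "(\<Sum>zs\<in>words n. chn Ch xs zs * ?f (xs ! t) (zs ! t) (\<gamma> zs t)) = 0" if t: "t \<in> ?I" for t
    proof -
      have tn: "t < length xs" using t n by auto
      have "(\<Sum>zs\<in>words n. chn Ch xs zs * ?f (xs ! t) (zs ! t) (\<gamma> zs t)) =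
        (\<Sum>zs\<in>words n. chn Ch xs zs *
          (\<Sum>z\<in>UNIV. Ch (xs ! t) z * ?f (xs ! t) (zs[t := z] ! t) (\<gamma> (zs[t := z]) t)))"
        by (rule chn_resample[OF st tn n])
      also have "\<dots> = (\<Sum>zs\<in>words n. chn Ch xs zs *
          (\<Sum>z\<in>UNIV. Ch (xs ! t) z * ?f (xs ! t) z (\<gamma> zs t)))"
        using t tn n \<gamma>(2) by (intro sum.cong arg_cong2[where f = "(*)"]) auto
      also have "\<dots> = 0" by (simp add: ell_unbiased[OF H])
      finally show ?thesis .
    qed
    have "?genie - (\<Sum>zs\<in>words n. chn Ch xs zs * (\<Sum>t\<in>?I. ?ell (zs ! t) (\<gamma> zs t)))
      = (\<Sum>zs\<in>words n. \<Sum>t\<in>?I. chn Ch xs zs * ?f (xs ! t) (zs ! t) (\<gamma> zs t))"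
      by (simp add: sum_distrib_left right_diff_distrib sum_subtractf)
    also have "\<dots> = (\<Sum>t\<in>?I. \<Sum>zs\<in>words n. chn Ch xs zs * ?f (xs ! t) (zs ! t) (\<gamma> zs t))"
      by (rule sum.swap)
    also have "\<dots> = 0" using z by simp
    finally show ?thesis by simp
  qed
  finally show ?thesis by simp
qed

subsection \<open>Bayes risk of finite windows\<close>

lemma sum_words_append3:
  fixes f :: "'a::finite list \<Rightarrow> real"
  shows "(\<Sum>xs\<in>words (a + (n + b)). f xs) =
    (\<Sum>u\<in>words a. \<Sum>v\<in>words n. \<Sum>w\<in>words b. f (u @ v @ w))"
  by (simp only: sum_words_append)

text \<open>By memorylessness the outputs outside the window sum to one for every input, so only the
  marginal of \<open>\<mu>\<close> on the window survives.\<close>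

lemma channel_margin:
  fixes \<mu> :: "'x::finite list \<Rightarrow> real" and Ch :: "'x \<Rightarrow> 'z::finite \<Rightarrow> real"
  assumes st: "stochastic Ch" and zv: "length zv = n"
  shows "(\<Sum>zu\<in>words a. \<Sum>zw\<in>words b. \<Sum>xs\<in>words (a + (n + b)).
      \<mu> xs * chn Ch xs (zu @ zv @ zw) * g (take n (drop a xs)))
    = (\<Sum>v\<in>words n. (\<Sum>u\<in>words a. \<Sum>w\<in>words b. \<mu> (u @ v @ w)) * chn Ch v zv * g v)"
proof -
  let ?g = "\<lambda>zu zw xs. \<mu> xs * chn Ch xs (zu @ zv @ zw) * g (take n (drop a xs))"
  have inner: "(\<Sum>zu\<in>words a. \<Sum>zw\<in>words b. ?g zu zw (u @ v @ w)) = \<mu> (u @ v @ w) * chn Ch v zv * g v"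
    if "length u = a" "length v = n" "length w = b" for u v w
  proof -
    have "?g zu zw (u @ v @ w) = (\<mu> (u @ v @ w) * chn Ch v zv * g v) * (chn Ch u zu * chn Ch w zw)"
      if "length zu = a" for zu zw
      using that \<open>length u = a\<close> \<open>length v = n\<close> zv by (simp add: chn_append)
    then have "(\<Sum>zu\<in>words a. \<Sum>zw\<in>words b. ?g zu zw (u @ v @ w)) =
      (\<Sum>zu\<in>words a. \<Sum>zw\<in>words b. (\<mu> (u @ v @ w) * chn Ch v zv * g v) * (chn Ch u zu * chn Ch w zw))"
      by (intro sum.cong refl) simp
    also have "\<dots> = (\<mu> (u @ v @ w) * chn Ch v zv * g v) *
        ((\<Sum>zu\<in>words a. chn Ch u zu) * (\<Sum>zw\<in>words b. chn Ch w zw))"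
      by (simp only: sum_distrib_left[symmetric] sum_distrib_right[symmetric])
    finally show ?thesis using that by (simp add: sum_chn[OF st])
  qed
  have "(\<Sum>zu\<in>words a. \<Sum>zw\<in>words b. \<Sum>xs\<in>words (a + (n + b)). ?g zu zw xs)
    = (\<Sum>zu\<in>words a. \<Sum>xs\<in>words (a + (n + b)). \<Sum>zw\<in>words b. ?g zu zw xs)"
    by (intro sum.cong refl sum.swap)
  also have "\<dots> = (\<Sum>xs\<in>words (a + (n + b)). \<Sum>zu\<in>words a. \<Sum>zw\<in>words b. ?g zu zw xs)"
    by (rule sum.swap)
  also have "\<dots> = (\<Sum>u\<in>words a. \<Sum>v\<in>words n. \<Sum>w\<in>words b. \<mu> (u @ v @ w) * chn Ch v zv * g v)"
    unfolding sum_words_append3 by (intro sum.cong refl inner) auto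
  also have "\<dots> = (\<Sum>v\<in>words n. \<Sum>u\<in>words a. \<Sum>w\<in>words b. \<mu> (u @ v @ w) * chn Ch v zv * g v)"
    by (rule sum.swap)
  finally show ?thesis by (simp only: sum_distrib_right)
qed

text \<open>Posterior expected loss times the probability of \<open>zs\<close>. Leaving it
  unnormalized avoids outputs of probability zero and lets the values for a longer window add up to
  those for a shorter one.\<close>

definition post_loss :: "('x::finite \<Rightarrow> 'z::finite \<Rightarrow> real) \<Rightarrow> ('x \<Rightarrow> 'xh::finite \<Rightarrow> real)
    \<Rightarrow> (nat \<Rightarrow> 'x) measure \<Rightarrow> nat \<Rightarrow> nat \<Rightarrow> 'z list \<Rightarrow> 'xh \<Rightarrow> real" where
  "post_loss Ch \<Lambda> Q n i zs y = (\<Sum>xs\<in>words n. pfx Q xs * chn Ch xs zs * \<Lambda> (xs ! i) y)"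

definition bayes_risk :: "('x::finite \<Rightarrow> 'z::finite \<Rightarrow> real) \<Rightarrow> ('x \<Rightarrow> 'xh::finite \<Rightarrow> real)
    \<Rightarrow> (nat \<Rightarrow> 'x) measure \<Rightarrow> nat \<Rightarrow> nat \<Rightarrow> real" where
  "bayes_risk Ch \<Lambda> Q n i = (\<Sum>zs\<in>words n. Min (range (post_loss Ch \<Lambda> Q n i zs)))"

definition bayes_rule :: "('x::finite \<Rightarrow> 'z::finite \<Rightarrow> real) \<Rightarrow> ('x \<Rightarrow> 'xh::finite \<Rightarrow> real)
    \<Rightarrow> (nat \<Rightarrow> 'x) measure \<Rightarrow> nat \<Rightarrow> nat \<Rightarrow> 'z list \<Rightarrow> 'xh" where
  "bayes_rule Ch \<Lambda> Q n i zs = (SOME y. post_loss Ch \<Lambda> Q n i zs y = Min (range (post_loss Ch \<Lambda> Q n i zs)))"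

lemma post_loss_bayes_rule:
  "post_loss Ch \<Lambda> Q n i zs (bayes_rule Ch \<Lambda> Q n i zs) = Min (range (post_loss Ch \<Lambda> Q n i zs))"
proof -
  have "Min (range (post_loss Ch \<Lambda> Q n i zs)) \<in> range (post_loss Ch \<Lambda> Q n i zs)"
    by (rule Min_in) auto
  then have "\<exists>y. post_loss Ch \<Lambda> Q n i zs y = Min (range (post_loss Ch \<Lambda> Q n i zs))"
    by (metis imageE)
  then show ?thesis unfolding bayes_rule_def by (rule someI_ex)
qed

lemma Min_post_loss_le: "Min (range (post_loss Ch \<Lambda> Q n i zs)) \<le> post_loss Ch \<Lambda> Q n i zs y"
  by (rule Min_le) auto

lemma bayes_risk_nonneg:
  assumes "stochastic Ch" "\<And>x y. 0 \<le> \<Lambda> x y"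
  shows "0 \<le> bayes_risk Ch \<Lambda> Q n i"
  unfolding bayes_risk_def post_loss_bayes_rule[symmetric] post_loss_def
  by (intro sum_nonneg mult_nonneg_nonneg pfx_nonneg chn_nonneg assms)

text \<open>A denoiser of the longer window may ignore the added symbols, and by stationarity the
  inner window has the same law wherever it sits.\<close>

lemma bayes_risk_mono:
  fixes Q :: "(nat \<Rightarrow> 'x::finite) measure" and Ch :: "'x \<Rightarrow> 'z::finite \<Rightarrow> real"
    and \<Lambda> :: "'x \<Rightarrow> 'xh::finite \<Rightarrow> real"
  assumes st: "stochastic Ch" and Q: "is_stationary Q" and i: "i < n"
  shows "bayes_risk Ch \<Lambda> Q (a + (n + b)) (a + i) \<le> bayes_risk Ch \<Lambda> Q n i"
proof -
  let ?p = "post_loss Ch \<Lambda> Q (a + (n + b)) (a + i)"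
  have marg: "(\<Sum>zu\<in>words a. \<Sum>zw\<in>words b. ?p (zu @ zv @ zw) y) = post_loss Ch \<Lambda> Q n i zv y"
    if zv: "length zv = n" for zv y
  proof -
    have "?p zs y = (\<Sum>xs\<in>words (a + (n + b)). pfx Q xs * chn Ch xs zs * \<Lambda> (take n (drop a xs) ! i) y)" for zs
      unfolding post_loss_def by (intro sum.cong refl) (use i in simp)
    then show ?thesis
      using channel_margin[OF st zv, where a = a and b = b and \<mu> = "pfx Q" and g = "\<lambda>v. \<Lambda> (v ! i) y"]
      by (simp only: sum_pfx_margin[OF Q] post_loss_def)
  qed
  have "bayes_risk Ch \<Lambda> Q (a + (n + b)) (a + i)
    = (\<Sum>zu\<in>words a. \<Sum>zv\<in>words n. \<Sum>zw\<in>words b. Min (range (?p (zu @ zv @ zw))))"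
    unfolding bayes_risk_def sum_words_append3 ..
  also have "\<dots> = (\<Sum>zv\<in>words n. \<Sum>zu\<in>words a. \<Sum>zw\<in>words b. Min (range (?p (zu @ zv @ zw))))"
    by (rule sum.swap)
  also have "\<dots> \<le> (\<Sum>zv\<in>words n. \<Sum>zu\<in>words a. \<Sum>zw\<in>words b.
      ?p (zu @ zv @ zw) (bayes_rule Ch \<Lambda> Q n i zv))"
    by (intro sum_mono Min_post_loss_le)
  also have "\<dots> = (\<Sum>zv\<in>words n. post_loss Ch \<Lambda> Q n i zv (bayes_rule Ch \<Lambda> Q n i zv))"
    by (intro sum.cong refl marg) simp
  also have "\<dots> = bayes_risk Ch \<Lambda> Q n i"
    by (simp add: bayes_risk_def post_loss_bayes_rule)
  finally show ?thesis .
qed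

text \<open>This infimum is the limit \<open>d\<^sub>a\<close> above, since the window risks decrease.\<close>

definition bayes_lim :: "('x::finite \<Rightarrow> 'z::finite \<Rightarrow> real) \<Rightarrow> ('x \<Rightarrow> 'xh::finite \<Rightarrow> real)
    \<Rightarrow> (nat \<Rightarrow> 'x) measure \<Rightarrow> real" where
  "bayes_lim Ch \<Lambda> Q = (INF k. bayes_risk Ch \<Lambda> Q (2 * k + 1) k)"

lemma bdd_below_bayes_risk:
  assumes "stochastic Ch" "\<And>x y. 0 \<le> \<Lambda> x y"
  shows "bdd_below (range (\<lambda>k. bayes_risk Ch \<Lambda> Q (2 * k + 1) k))"
  by (rule bdd_belowI2[where m = 0]) (rule bayes_risk_nonneg[OF assms])

lemma bayes_lim_le_window:
  assumes "stochastic Ch" "\<And>x y. 0 \<le> \<Lambda> x y"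
  shows "bayes_lim Ch \<Lambda> Q \<le> bayes_risk Ch \<Lambda> Q (2 * k + 1) k"
  unfolding bayes_lim_def by (rule cINF_lower[OF bdd_below_bayes_risk[OF assms]]) simp

lemma bayes_lim_le:
  assumes st: "stochastic Ch" and \<Lambda>: "\<And>x y. 0 \<le> \<Lambda> x y" and Q: "is_stationary Q" and i: "i < n"
  shows "bayes_lim Ch \<Lambda> Q \<le> bayes_risk Ch \<Lambda> Q n i"
proof -
  define j where "j = n - 1 - i"
  \<comment> \<open>\<open>i\<close> symbols precede the target and \<open>j\<close> follow it.
    Padding the shorter side makes the window symmetric and discards no observation.\<close>
  define k where "k = max i j"
  have e: "(k - i) + (n + (k - j)) = 2 * k + 1" "(k - i) + i = k"
    using i by (auto simp: k_def j_def)
  have "bayes_lim Ch \<Lambda> Q \<le> bayes_risk Ch \<Lambda> Q (2 * k + 1) k"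
    by (rule bayes_lim_le_window[OF st \<Lambda>])
  also have "\<dots> \<le> bayes_risk Ch \<Lambda> Q n i"
    using bayes_risk_mono[OF st Q i, of \<Lambda> "k - i" "k - j"] unfolding e .
  finally show ?thesis .
qed

lemma bayes_risk_tendsto:
  assumes st: "stochastic Ch" and \<Lambda>: "\<And>x y. 0 \<le> \<Lambda> x y" and Q: "is_stationary Q"
  shows "(\<lambda>k. bayes_risk Ch \<Lambda> Q (2 * k + 1) k) \<longlonglongrightarrow> bayes_lim Ch \<Lambda> Q"
  unfolding bayes_lim_def
proof (rule LIMSEQ_decseq_INF[OF bdd_below_bayes_risk[OF st \<Lambda>]])
  show "decseq (\<lambda>k. bayes_risk Ch \<Lambda> Q (2 * k + 1) k)"
  proof (rule decseq_SucI)
    fix k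
    have "1 + ((2 * k + 1) + 1) = 2 * Suc k + 1" "1 + k = Suc k" by auto
    then show "bayes_risk Ch \<Lambda> Q (2 * Suc k + 1) (Suc k) \<le> bayes_risk Ch \<Lambda> Q (2 * k + 1) k"
      using bayes_risk_mono[OF st Q, of k "2 * k + 1" \<Lambda> 1 1] by simp
  qed
qed

text \<open>A weight on strings of length \<open>n\<close> is \<open>block_at\<close> for \<open>q\<close>, \<open>s\<close>, \<open>e\<close> if under it the segment
  \<open>[s, e)\<close> has the law \<open>q\<close> and is independent of the rest.\<close>

definition block_at :: "nat \<Rightarrow> ('x::finite list \<Rightarrow> real) \<Rightarrow> (nat \<Rightarrow> 'x) measure \<Rightarrow> nat \<Rightarrow> nat \<Rightarrow> bool" where
  "block_at n W q s e \<longleftrightarrow> s \<le> e \<and> e \<le> n \<and>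
    (\<exists>F G. (\<forall>u. 0 \<le> F u) \<and> (\<forall>w. 0 \<le> G w) \<and>
      (\<Sum>u\<in>words s. F u) = (1 :: real) \<and> (\<Sum>w\<in>words (n - e). G w) = (1 :: real) \<and>
      (\<forall>u v w. length u = s \<longrightarrow> length v = e - s \<longrightarrow> W (u @ v @ w) = F u * pfx q v * G w))"

text \<open>The symbols outside the block sum out through \<open>F\<close> and \<open>G\<close>,
  those of the block outside the window through stationarity. So the place of the window within the
  block is irrelevant.\<close>

lemma block_at_margin:
  assumes W: "block_at n W q s e" and q: "is_stationary q" and ab: "s \<le> a" "a + l \<le> e"
    and v: "length v = l"
  shows "(\<Sum>u\<in>words a. \<Sum>w\<in>words (n - (a + l)). W (u @ v @ w)) = pfx q v"
proof -
  obtain F G where FG: "(\<Sum>u\<in>words s. F u) = (1 :: real)" "(\<Sum>w\<in>words (n - e). G w) = (1 :: real)"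
    "\<And>u v w. length u = s \<Longrightarrow> length v = e - s \<Longrightarrow> W (u @ v @ w) = F u * pfx q v * G w"
    and se: "s \<le> e" "e \<le> n"
    using W unfolding block_at_def by blast
  have l: "a = s + (a - s)" "n - (a + l) = (e - (a + l)) + (n - e)" using ab se by auto
  have "(\<Sum>u\<in>words a. \<Sum>w\<in>words (n - (a + l)). W (u @ v @ w)) =
    (\<Sum>u\<in>words (s + (a - s)). \<Sum>w\<in>words ((e - (a + l)) + (n - e)). W (u @ v @ w))"
    using l by simp
  also have "\<dots> = (\<Sum>u\<in>words s. \<Sum>u'\<in>words (a - s). \<Sum>w\<in>words (e - (a + l)). \<Sum>w'\<in>words (n - e).
      W (u @ (u' @ v @ w) @ w'))"
    unfolding sum_words_append by simp
  also have "\<dots> = (\<Sum>u\<in>words s. \<Sum>u'\<in>words (a - s). \<Sum>w\<in>words (e - (a + l)). \<Sum>w'\<in>words (n - e).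
      F u * pfx q (u' @ v @ w) * G w')"
    by (intro sum.cong refl FG) (use ab v in auto)
  also have "\<dots> = (\<Sum>u\<in>words s. F u) *
      (\<Sum>u'\<in>words (a - s). \<Sum>w\<in>words (e - (a + l)). pfx q (u' @ v @ w)) * (\<Sum>w'\<in>words (n - e). G w')"
    by (simp only: sum_distrib_left[symmetric] sum_distrib_right[symmetric])
  also have "\<dots> = pfx q v"
    unfolding FG sum_pfx_margin[OF q] by simp
  finally show ?thesis .
qed

lemma block_at_total:
  assumes W: "block_at n W q s e" and q: "is_stationary q"
  shows "(\<Sum>xs\<in>words n. W xs) = 1"
proof -
  have se: "s \<le> e" "e \<le> n" using W by (auto simp: block_at_def)
  have n: "n = s + (0 + (n - s))" using se by simp
  have "(\<Sum>xs\<in>words n. W xs) = (\<Sum>u\<in>words s. \<Sum>v\<in>words 0. \<Sum>w\<in>words (n - s). W (u @ v @ w))"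
    by (subst n) (rule sum_words_append3)
  also have "\<dots> = (\<Sum>u\<in>words s. \<Sum>w\<in>words (n - (s + 0)). W (u @ [] @ w))" by simp
  also have "\<dots> = pfx q []" by (rule block_at_margin[OF W q]) (use se in auto)
  also have "\<dots> = 1" using q by (intro pfx_Nil) (simp add: is_stationary_def)
  finally show ?thesis .
qed

lemma window_eq_ctx:
  assumes "k \<le> t" "t + k < length zs"
  shows "take (2 * k + 1) (drop (t - k) zs) = fst (ctx k zs t) @ zs ! t # snd (ctx k zs t)"
proof -
  have "take (k + (1 + k)) (drop (t - k) zs) =
    take k (drop (t - k) zs) @ take (1 + k) (drop (k + (t - k)) zs)"
    by (simp only: take_add drop_drop)
  also have "take (1 + k) (drop (k + (t - k)) zs) = zs ! t # take k (drop (Suc t) zs)"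
    using assms by (simp add: Cons_nth_drop_Suc[symmetric])
  finally show ?thesis by (simp add: ctx_def mult_2)
qed

text \<open>The current symbol is a separate argument: at each time a map on symbols is chosen from
  regime and context alone, which gives a rule sequence of the kind compared in
  \<open>Skm\<close>.\<close>

definition genie :: "('x::finite \<Rightarrow> 'z::finite \<Rightarrow> real) \<Rightarrow> ('x \<Rightarrow> 'xh::finite \<Rightarrow> real)
    \<Rightarrow> (nat \<Rightarrow> (nat \<Rightarrow> 'x) measure) \<Rightarrow> nat list \<Rightarrow> nat \<Rightarrow> 'z list \<Rightarrow> nat \<Rightarrow> 'z \<Rightarrow> 'xh" where
  "genie Ch \<Lambda> Q as k zs t z =
     bayes_rule Ch \<Lambda> (Q (as ! t)) (2 * k + 1) k (fst (ctx k zs t) @ z # snd (ctx k zs t))"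

text \<open>If the window around \<open>t\<close> stays inside the block, its input has the
  stationary law of the current regime, and the rule is the Bayes rule for exactly this law.\<close>

lemma genie_loss:
  fixes Ch :: "'x::finite \<Rightarrow> 'z::finite \<Rightarrow> real" and \<Lambda> :: "'x \<Rightarrow> 'xh::finite \<Rightarrow> real"
  assumes st: "stochastic Ch" and q: "is_stationary (Q (as ! t))"
    and W: "block_at n W (Q (as ! t)) s e" and win: "s + k \<le> t" "t + k < e"
  shows "(\<Sum>xs\<in>words n. W xs * (\<Sum>zs\<in>words n. chn Ch xs zs * \<Lambda> (xs ! t) (genie Ch \<Lambda> Q as k zs t (zs ! t))))
    = bayes_risk Ch \<Lambda> (Q (as ! t)) (2 * k + 1) k"
proof -
  let ?q = "Q (as ! t)" and ?l = "2 * k + 1"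
  let ?r = "bayes_rule Ch \<Lambda> ?q ?l k"
  define a where "a = t - k"
  define b where "b = n - (a + ?l)"
  have en: "e \<le> n" using W by (simp add: block_at_def)
  have n: "n = a + (?l + b)" and a: "s \<le> a" "a + ?l \<le> e" "a + k = t"
    using win en by (auto simp: a_def b_def)
  have "(\<Sum>xs\<in>words n. W xs * (\<Sum>zs\<in>words n. chn Ch xs zs * \<Lambda> (xs ! t) (genie Ch \<Lambda> Q as k zs t (zs ! t))))
    = (\<Sum>xs\<in>words n. \<Sum>zs\<in>words n. W xs * chn Ch xs zs *
         \<Lambda> (take ?l (drop a xs) ! k) (?r (take ?l (drop a zs))))"
    unfolding sum_distrib_left
  proof (intro sum.cong refl)
    fix xs :: "'x list" and zs :: "'z list" assume "xs \<in> words n" "zs \<in> words n"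
    then have l: "length xs = n" "length zs = n" by auto
    have "genie Ch \<Lambda> Q as k zs t (zs ! t) = ?r (take ?l (drop a zs))"
      using win en l by (simp only: genie_def a_def window_eq_ctx)
    moreover have "xs ! t = take ?l (drop a xs) ! k"
      using win en l a by simp
    ultimately show "W xs * (chn Ch xs zs * \<Lambda> (xs ! t) (genie Ch \<Lambda> Q as k zs t (zs ! t))) =
      W xs * chn Ch xs zs * \<Lambda> (take ?l (drop a xs) ! k) (?r (take ?l (drop a zs)))"
      by (simp only: mult.assoc)
  qed
  also have "\<dots> = (\<Sum>zs\<in>words n. \<Sum>xs\<in>words n. W xs * chn Ch xs zs *
         \<Lambda> (take ?l (drop a xs) ! k) (?r (take ?l (drop a zs))))"
    by (rule sum.swap)
  also have "\<dots> = (\<Sum>zu\<in>words a. \<Sum>zv\<in>words ?l. \<Sum>zw\<in>words b. \<Sum>xs\<in>words (a + (?l + b)).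
      W xs * chn Ch xs (zu @ zv @ zw) * \<Lambda> (take ?l (drop a xs) ! k) (?r (take ?l (drop a (zu @ zv @ zw)))))"
    unfolding n sum_words_append3 ..
  also have "\<dots> = (\<Sum>zu\<in>words a. \<Sum>zv\<in>words ?l. \<Sum>zw\<in>words b. \<Sum>xs\<in>words (a + (?l + b)).
      W xs * chn Ch xs (zu @ zv @ zw) * \<Lambda> (take ?l (drop a xs) ! k) (?r zv))"
    by (intro sum.cong refl) simp
  also have "\<dots> = (\<Sum>zv\<in>words ?l. \<Sum>zu\<in>words a. \<Sum>zw\<in>words b. \<Sum>xs\<in>words (a + (?l + b)).
      W xs * chn Ch xs (zu @ zv @ zw) * \<Lambda> (take ?l (drop a xs) ! k) (?r zv))"
    by (rule sum.swap)
  also have "\<dots> = (\<Sum>zv\<in>words ?l. post_loss Ch \<Lambda> ?q ?l k zv (?r zv))"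
  proof (rule sum.cong[OF refl])
    fix zv :: "'z list" assume "zv \<in> words ?l"
    then have zv: "length zv = ?l" by simp
    have "(\<Sum>zu\<in>words a. \<Sum>zw\<in>words b. \<Sum>xs\<in>words (a + (?l + b)).
      W xs * chn Ch xs (zu @ zv @ zw) * \<Lambda> (take ?l (drop a xs) ! k) (?r zv))
      = (\<Sum>v\<in>words ?l. (\<Sum>u\<in>words a. \<Sum>w\<in>words b. W (u @ v @ w)) * chn Ch v zv * \<Lambda> (v ! k) (?r zv))"
      by (rule channel_margin[OF st zv])
    also have "\<dots> = (\<Sum>v\<in>words ?l. pfx ?q v * chn Ch v zv * \<Lambda> (v ! k) (?r zv))"
    proof (rule sum.cong[OF refl])
      fix v :: "'x list" assume "v \<in> words ?l"
      then show "(\<Sum>u\<in>words a. \<Sum>w\<in>words b. W (u @ v @ w)) * chn Ch v zv * \<Lambda> (v ! k) (?r zv)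
        = pfx ?q v * chn Ch v zv * \<Lambda> (v ! k) (?r zv)"
        unfolding b_def by (subst block_at_margin[OF W q a(1,2)]) auto
    qed
    finally show "(\<Sum>zu\<in>words a. \<Sum>zw\<in>words b. \<Sum>xs\<in>words (a + (?l + b)).
      W xs * chn Ch xs (zu @ zv @ zw) * \<Lambda> (take ?l (drop a xs) ! k) (?r zv))
      = post_loss Ch \<Lambda> ?q ?l k zv (?r zv)"
      by (simp only: post_loss_def)
  qed
  also have "\<dots> = bayes_risk Ch \<Lambda> ?q ?l k"
    by (simp only: bayes_risk_def post_loss_bayes_rule)
  finally show ?thesis .
qed

text \<open>The observations outside the block are independent of the block. Freezing them turns
  \<open>d\<close> into a denoiser of the block alone, which cannot go below the posterior
  minimum.\<close>

lemma block_loss_ge: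
  fixes Ch :: "'x::finite \<Rightarrow> 'z::finite \<Rightarrow> real" and \<Lambda> :: "'x \<Rightarrow> 'xh::finite \<Rightarrow> real"
  assumes st: "stochastic Ch"
    and W: "block_at n W q s e" and t: "s \<le> t" "t < e"
  shows "bayes_risk Ch \<Lambda> q (e - s) (t - s)
    \<le> (\<Sum>xs\<in>words n. W xs * (\<Sum>zs\<in>words n. chn Ch xs zs * \<Lambda> (xs ! t) (d zs)))"
proof -
  obtain F G where pos: "\<And>u. 0 \<le> F u" "\<And>w. 0 \<le> G w"
    and FG: "(\<Sum>u\<in>words s. F u) = (1 :: real)" "(\<Sum>w\<in>words (n - e). G w) = (1 :: real)"
    "\<And>u v w. length u = s \<Longrightarrow> length v = e - s \<Longrightarrow> W (u @ v @ w) = F u * pfx q v * G w"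
    and se: "s \<le> e" "e \<le> n"
    using W unfolding block_at_def by blast
  let ?l = "e - s" and ?b = "n - e"
  have n: "n = s + (?l + ?b)" using se by simp
  \<comment> \<open>\<open>f\<close> and \<open>g\<close> are the laws of the outputs before and
    after the block.\<close>
  define f where "f = (\<lambda>zu. \<Sum>u\<in>words s. F u * chn Ch u zu)"
  define g where "g = (\<lambda>zw. \<Sum>w\<in>words ?b. G w * chn Ch w zw)"
  let ?p = "post_loss Ch \<Lambda> q ?l (t - s)"
  have f: "(\<Sum>zu\<in>words s. f zu) = 1" and g: "(\<Sum>zw\<in>words ?b. g zw) = 1"
  proof -
    have "(\<Sum>zu\<in>words s. f zu) = (\<Sum>u\<in>words s. F u * (\<Sum>zu\<in>words s. chn Ch u zu))"
      unfolding f_def sum_distrib_left by (rule sum.swap)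
    also have "\<dots> = (\<Sum>u\<in>words s. F u)" by (intro sum.cong refl) (simp add: sum_chn[OF st])
    finally show "(\<Sum>zu\<in>words s. f zu) = 1" using FG by simp
    have "(\<Sum>zu\<in>words ?b. g zu) = (\<Sum>u\<in>words ?b. G u * (\<Sum>zu\<in>words ?b. chn Ch u zu))"
      unfolding g_def sum_distrib_left by (rule sum.swap)
    also have "\<dots> = (\<Sum>u\<in>words ?b. G u)" by (intro sum.cong refl) (simp add: sum_chn[OF st])
    finally show "(\<Sum>zw\<in>words ?b. g zw) = 1" using FG by simp
  qed
  have fg0: "0 \<le> f zu" "0 \<le> g zw" for zu zw
    unfolding f_def g_def by (intro sum_nonneg mult_nonneg_nonneg pos chn_nonneg st)+
  have inner: "(\<Sum>xs\<in>words n. W xs * chn Ch xs (zu @ zv @ zw) * \<Lambda> (xs ! t) y) = f zu * ?p zv y * g zw"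
    if z: "length zu = s" "length zv = ?l" for zu zv zw y
  proof -
    have "(\<Sum>xs\<in>words n. W xs * chn Ch xs (zu @ zv @ zw) * \<Lambda> (xs ! t) y) =
      (\<Sum>u\<in>words s. \<Sum>v\<in>words ?l. \<Sum>w\<in>words ?b.
         W (u @ v @ w) * chn Ch (u @ v @ w) (zu @ zv @ zw) * \<Lambda> ((u @ v @ w) ! t) y)"
      by (subst n) (rule sum_words_append3)
    also have "\<dots> = (\<Sum>u\<in>words s. \<Sum>v\<in>words ?l. \<Sum>w\<in>words ?b.
         (F u * chn Ch u zu) * ((pfx q v * chn Ch v zv * \<Lambda> (v ! (t - s)) y) * (G w * chn Ch w zw)))"
    proof (intro sum.cong refl)
      fix u v w :: "'x list" assume "u \<in> words s" "v \<in> words ?l" "w \<in> words ?b"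
      then show "W (u @ v @ w) * chn Ch (u @ v @ w) (zu @ zv @ zw) * \<Lambda> ((u @ v @ w) ! t) y =
        (F u * chn Ch u zu) * ((pfx q v * chn Ch v zv * \<Lambda> (v ! (t - s)) y) * (G w * chn Ch w zw))"
        using z t by (simp add: FG(3) chn_append nth_append diff_less_mono)
    qed
    also have "\<dots> = f zu * (?p zv y * g zw)"
      unfolding f_def g_def post_loss_def sum_product by (simp only: sum_distrib_left sum_distrib_right)
    finally show ?thesis by (simp only: mult.assoc)
  qed
  have "bayes_risk Ch \<Lambda> q ?l (t - s) = (\<Sum>zu\<in>words s. f zu) * ((\<Sum>zv\<in>words ?l. Min (range (?p zv))) * (\<Sum>zw\<in>words ?b. g zw))"
    unfolding f g bayes_risk_def by simp
  also have "\<dots> = (\<Sum>zu\<in>words s. \<Sum>zv\<in>words ?l. \<Sum>zw\<in>words ?b. f zu * Min (range (?p zv)) * g zw)"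
    unfolding sum_product by (simp only: sum_distrib_left sum_distrib_right mult.assoc)
  also have "\<dots> \<le> (\<Sum>zu\<in>words s. \<Sum>zv\<in>words ?l. \<Sum>zw\<in>words ?b. f zu * ?p zv (d (zu @ zv @ zw)) * g zw)"
    by (intro sum_mono mult_right_mono mult_left_mono fg0 Min_post_loss_le)
  also have "\<dots> = (\<Sum>zu\<in>words s. \<Sum>zv\<in>words ?l. \<Sum>zw\<in>words ?b.
      \<Sum>xs\<in>words n. W xs * chn Ch xs (zu @ zv @ zw) * \<Lambda> (xs ! t) (d (zu @ zv @ zw)))"
    by (intro sum.cong refl inner[symmetric]) auto
  also have "\<dots> = (\<Sum>zs\<in>words n. \<Sum>xs\<in>words n. W xs * chn Ch xs zs * \<Lambda> (xs ! t) (d zs))"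
  proof -
    have "(\<Sum>zs\<in>words n. h zs) =
      (\<Sum>zu\<in>words s. \<Sum>zv\<in>words ?l. \<Sum>zw\<in>words ?b. h (zu @ zv @ zw))" for h :: "'z list \<Rightarrow> real"
      by (subst n) (rule sum_words_append3)
    then show ?thesis by (rule sym)
  qed
  also have "\<dots> = (\<Sum>xs\<in>words n. \<Sum>zs\<in>words n. W xs * chn Ch xs zs * \<Lambda> (xs ! t) (d zs))"
    by (rule sum.swap)
  finally show ?thesis by (simp only: sum_distrib_left mult.assoc)
qed

subsection \<open>Regret of the S-DUDE\<close>

lemma nswitch_eq_card_shifts: "nswitch as = card (shifts {..<length as} (\<lambda>t. as ! t))"
proof -
  let ?J = "{j. Suc j < length as \<and> as ! j \<noteq> as ! Suc j}"
  have "shifts {..<length as} (\<lambda>t. as ! t) = (\<lambda>j. (j, Suc j)) ` ?J"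
  proof (intro set_eqI iffI)
    fix p assume p: "p \<in> shifts {..<length as} (\<lambda>t. as ! t)"
    obtain i j where ij: "p = (i, j)" by (cases p)
    have *: "i < j" "j < length as" "as ! i \<noteq> as ! j" "\<And>l. l < length as \<Longrightarrow> \<not> (i < l \<and> l < j)"
      using p by (auto simp: ij shifts_def)
    have "j = Suc i" using *(4)[of "Suc i"] *(1,2) by auto
    then show "p \<in> (\<lambda>j. (j, Suc j)) ` ?J" using * by (auto simp: ij)
  qed (auto simp: shifts_def)
  then show ?thesis by (simp add: nswitch_def card_image inj_on_def)
qed

lemma genie_update: "k \<le> t \<Longrightarrow> genie Ch \<Lambda> Q as k (zs[t := z]) t = genie Ch \<Lambda> Q as k zs t"
  by (rule ext) (simp add: genie_def ctx_update)

text \<open>Within one context class the genie's rule is a function of the regime, so a change of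
  rule is a change of regime. Along a class there are at most as many of these as switches in the
  whole regime string.\<close>

lemma genie_Skm:
  assumes "length zs = length as" "nswitch as \<le> m"
  shows "genie Ch \<Lambda> Q as k zs \<in> Skm k m zs"
  unfolding Skm_iff
proof
  fix c
  have fin: "finite (Tset k zs c)"
    by (rule finite_subset[of _ "{..<length zs}"]) (auto simp: Tset_def)
  have "shifts (Tset k zs c) (genie Ch \<Lambda> Q as k zs) \<subseteq> shifts (Tset k zs c) (\<lambda>t. as ! t)"
  proof
    fix p assume p: "p \<in> shifts (Tset k zs c) (genie Ch \<Lambda> Q as k zs)"
    obtain i j where ij: "p = (i, j)" by (cases p)
    have T: "i \<in> Tset k zs c" "j \<in> Tset k zs c"
      and ne: "genie Ch \<Lambda> Q as k zs i \<noteq> genie Ch \<Lambda> Q as k zs j"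
      using p by (auto simp: ij shifts_def)
    have "ctx k zs i = ctx k zs j" using T by (simp add: Tset_def)
    then have "as ! i \<noteq> as ! j" using ne by (auto simp: genie_def fun_eq_iff)
    then show "p \<in> shifts (Tset k zs c) (\<lambda>t. as ! t)"
      using p unfolding ij shifts_def by blast
  qed
  then have "card (shifts (Tset k zs c) (genie Ch \<Lambda> Q as k zs)) \<le> card (shifts (Tset k zs c) (\<lambda>t. as ! t))"
    by (rule card_mono[OF finite_shifts[OF fin]])
  also have "\<dots> \<le> card (shifts {..<length as} (\<lambda>t. as ! t))"
    by (rule card_shifts_mono) (use assms in \<open>auto simp: Tset_def\<close>)
  also have "\<dots> \<le> m" using assms by (simp add: nswitch_eq_card_shifts)
  finally show "card (shifts (Tset k zs c) (genie Ch \<Lambda> Q as k zs)) \<le> m" .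
qed

lemma block_prod_nonneg: "0 \<le> block_prod Q as xs"
  unfolding block_prod_def Let_def by (intro prod_nonneg ballI pfx_nonneg)

lemma block_prod_block_at:
  fixes Q :: "nat \<Rightarrow> (nat \<Rightarrow> 'x::finite) measure"
  assumes t: "t < n" "length as = n" and Q: "\<And>a. a \<in> set as \<Longrightarrow> is_stationary (Q a)"
  obtains s e where "block_at n (block_prod Q as) (Q (as ! t)) s e" "s \<le> t" "t < e"
    "s = 0 \<or> as ! (s - 1) \<noteq> as ! s" "e = n \<or> as ! (e - 1) \<noteq> as ! e"
proof (rule block_prod_factor[OF t, of Q])
  show "is_process (Q a)" if "a \<in> set as" for a
    using Q[OF that] by (simp add: is_stationary_def)
next
  fix s e F G
  assume *: "s \<le> t" "t < e" "e \<le> n"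
    "s = 0 \<or> as ! (s - 1) \<noteq> as ! s" "e = n \<or> as ! (e - 1) \<noteq> as ! e"
    "\<And>u. 0 \<le> F u" "\<And>w. 0 \<le> G w"
    "(\<Sum>u\<in>words s. F u) = (1 :: real)" "(\<Sum>w\<in>words (n - e). G w) = (1 :: real)"
    "\<And>u v w. length u = s \<Longrightarrow> length v = e - s \<Longrightarrow>
       block_prod Q as (u @ v @ w) = F u * pfx (Q (as ! t)) v * G w"
  have "s \<le> e" using * by simp
  then have "block_at n (block_prod Q as) (Q (as ! t)) s e"
    unfolding block_at_def using *(3,6-10) by blast
  then show ?thesis using *(1,2,4,5) by (rule that)
qed

section \<open>Loss at a single position given the regime string\<close>

definition weighted_loss :: "('x::finite \<Rightarrow> 'z::finite \<Rightarrow> real) \<Rightarrow> ('x \<Rightarrow> 'xh \<Rightarrow> real)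
    \<Rightarrow> nat \<Rightarrow> ('x list \<Rightarrow> real) \<Rightarrow> ('z list \<Rightarrow> nat \<Rightarrow> 'xh) \<Rightarrow> nat \<Rightarrow> real" where
  "weighted_loss Ch \<Lambda> n W D t =
     (\<Sum>xs\<in>words n. W xs * (\<Sum>zs\<in>words n. chn Ch xs zs * \<Lambda> (xs ! t) (D zs t)))"

lemma sum_weighted_loss:
  "(\<Sum>t\<in>I. weighted_loss Ch \<Lambda> n W D t) =
    (\<Sum>xs\<in>words n. W xs * (\<Sum>zs\<in>words n. chn Ch xs zs * (\<Sum>t\<in>I. \<Lambda> (xs ! t) (D zs t))))"
proof -
  let ?g = "\<lambda>t xs zs. W xs * (chn Ch xs zs * \<Lambda> (xs ! t) (D zs t))"
  have "(\<Sum>t\<in>I. \<Sum>xs\<in>words n. \<Sum>zs\<in>words n. ?g t xs zs) = (\<Sum>xs\<in>words n. \<Sum>t\<in>I. \<Sum>zs\<in>words n. ?g t xs zs)"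
    by (rule sum.swap)
  also have "\<dots> = (\<Sum>xs\<in>words n. \<Sum>zs\<in>words n. \<Sum>t\<in>I. ?g t xs zs)"
    by (intro sum.cong refl sum.swap)
  finally show ?thesis unfolding weighted_loss_def sum_distrib_left .
qed

text \<open>\<open>D\<close> is arbitrary here, so the bound covers even a denoiser chosen with
  knowledge of \<open>as\<close>.\<close>

lemma weighted_loss_ge:
  fixes Ch :: "'x::finite \<Rightarrow> 'z::finite \<Rightarrow> real" and \<Lambda> :: "'x \<Rightarrow> 'xh::finite \<Rightarrow> real"
  assumes st: "stochastic Ch" and \<Lambda>: "\<And>x y. 0 \<le> \<Lambda> x y"
    and t: "t < n" "length as = n" and Q: "\<And>a. a \<in> set as \<Longrightarrow> is_stationary (Q a)"
  shows "bayes_lim Ch \<Lambda> (Q (as ! t)) \<le> weighted_loss Ch \<Lambda> n (block_prod Q as) D t"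
proof -
  obtain s e where W: "block_at n (block_prod Q as) (Q (as ! t)) s e" and se: "s \<le> t" "t < e"
    by (rule block_prod_block_at[OF t Q])
  have "is_stationary (Q (as ! t))" using Q t by simp
  then have "bayes_lim Ch \<Lambda> (Q (as ! t)) \<le> bayes_risk Ch \<Lambda> (Q (as ! t)) (e - s) (t - s)"
    by (intro bayes_lim_le[OF st \<Lambda>]) (use se in auto)
  also have "\<dots> \<le> weighted_loss Ch \<Lambda> n (block_prod Q as) D t"
    unfolding weighted_loss_def by (rule block_loss_ge[OF st W se])
  finally show ?thesis .
qed

lemma weighted_loss_le:
  assumes st: "stochastic Ch" and B: "\<And>x y. \<Lambda> x y \<le> B"
    and W: "\<And>xs. 0 \<le> W xs" "(\<Sum>xs\<in>words n. W xs) = 1"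
  shows "weighted_loss Ch \<Lambda> n W D t \<le> B"
proof -
  have "weighted_loss Ch \<Lambda> n W D t \<le> (\<Sum>xs\<in>words n. W xs * (\<Sum>zs\<in>words n. chn Ch xs zs * B))"
    unfolding weighted_loss_def by (intro sum_mono mult_left_mono W chn_nonneg st B)
  also have "\<dots> = (\<Sum>xs\<in>words n. W xs * B)"
    by (intro sum.cong refl) (simp add: sum_chn[OF st] flip: sum_distrib_right)
  also have "\<dots> = B" using W by (simp flip: sum_distrib_right)
  finally show ?thesis .
qed

lemma bayes_lim_nonneg:
  assumes "stochastic Ch" "\<And>x y. 0 \<le> \<Lambda> x y"
  shows "0 \<le> bayes_lim Ch \<Lambda> Q"
  unfolding bayes_lim_def by (rule cINF_greatest) (simp, rule bayes_risk_nonneg[OF assms])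

text \<open>The window around \<open>t\<close> contains both \<open>j\<close> and
  \<open>j + 1\<close> exactly for \<open>t\<close> from \<open>j + 1 - k\<close> to
  \<open>j + k\<close>, so one switch spoils at most \<open>2 * k\<close> windows.\<close>

lemma card_near_switch:
  "card {t. \<exists>j. t \<le> j + k \<and> j < t + k \<and> Suc j < length as \<and> as ! j \<noteq> as ! Suc j} \<le> 2 * k * nswitch as"
    (is "card ?bad \<le> _")
proof -
  let ?J = "{j. Suc j < length as \<and> as ! j \<noteq> as ! Suc j}"
  have finJ: "finite ?J" by (rule finite_subset[of _ "{..<length as}"]) auto
  have "card ?bad \<le> card (\<Union>j\<in>?J. {j + 1 - k..j + k})"
    by (rule card_mono) (use finJ in auto)
  also have "\<dots> \<le> (\<Sum>j\<in>?J. card {j + 1 - k..j + k})" by (rule card_UN_le[OF finJ])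
  also have "\<dots> \<le> (\<Sum>j\<in>?J. 2 * k)" by (rule sum_mono) auto
  finally show ?thesis by (simp add: nswitch_def mult.commute)
qed

text \<open>The loss is charged by position: the \<open>2 * k\<close> border positions and at most
  \<open>2 * k * m\<close> positions near a switch cost \<open>B\<close> each, every other one
  exceeds its limit by at most \<open>\<Delta>\<close>. The first two items give the term with
  \<open>(k + 1) * (m + 1)\<close>.\<close>

lemma sdude_weighted_loss_le:
  fixes \<Lambda> :: "'x::finite \<Rightarrow> 'xh::finite \<Rightarrow> real" and Ch :: "'x \<Rightarrow> 'z::finite \<Rightarrow> real"
  assumes st: "stochastic Ch" and H: "right_inverse Ch H"
    and \<Lambda>: "\<And>x y. 0 \<le> \<Lambda> x y" and B: "\<And>x y. \<Lambda> x y \<le> B"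
    and k: "2 * k < n" and m: "m \<le> (n - 2 * k) div 2"
    and M: "\<And>x z s. \<bar>\<Lambda> x (s z) - ell Ch H \<Lambda> z s\<bar> \<le> M" and l: "0 < l" "l * M \<le> 1"
    and D: "is_sdude Ch H \<Lambda> k m n D"
    and as: "length as = n" "nswitch as \<le> m" and Q: "\<And>a. a \<in> set as \<Longrightarrow> is_stationary (Q a)"
    and \<Delta>: "\<And>a. a \<in> set as \<Longrightarrow> bayes_risk Ch \<Lambda> (Q a) (2 * k + 1) k \<le> bayes_lim Ch \<Lambda> (Q a) + \<Delta>" "0 \<le> \<Delta>"
  shows "(\<Sum>t<n. weighted_loss Ch \<Lambda> n (block_prod Q as) D t)
    \<le> (\<Sum>t<n. bayes_lim Ch \<Lambda> (Q (as ! t))) + real n * \<Delta> + 2 * B * (real (k + 1) * real (m + 1))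
      + (real (k + 1) * (real CARD('z) ^ (2 * k) * (real (n - 2 * k) * hb (real m / real (n - 2 * k))
          + real (m + 1) * ln (real CARD('z \<Rightarrow> 'xh)))) / l + l * M\<^sup>2 * real (n - 2 * k))"
    (is "_ \<le> _ + _ + _ + ?dev")
proof -
  let ?W = "block_prod Q as" and ?I = "{k..<n - k}" and ?\<gamma> = "genie Ch \<Lambda> Q as k"
  let ?lim = "\<lambda>t. bayes_lim Ch \<Lambda> (Q (as ! t))"
  define bad where "bad = {t. \<exists>j. t \<le> j + k \<and> j < t + k \<and> Suc j < length as \<and> as ! j \<noteq> as ! Suc j}"
  have B0: "0 \<le> B" using \<Lambda> B order_trans by blast
  have n0: "0 < n" using k by simp
  have W1: "(\<Sum>xs\<in>words n. ?W xs) = 1"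
  proof -
    obtain s e where "block_at n ?W (Q (as ! 0)) s e"
      by (rule block_prod_block_at[OF n0 as(1) Q])
    moreover have "is_stationary (Q (as ! 0))" using Q n0 as(1) by simp
    ultimately show ?thesis by (rule block_at_total)
  qed
  note le_B = weighted_loss_le[OF st B block_prod_nonneg W1]
  have in_I: "(\<Sum>t\<in>?I. weighted_loss Ch \<Lambda> n ?W D t)
    \<le> (\<Sum>t\<in>?I. weighted_loss Ch \<Lambda> n ?W (\<lambda>zs t. ?\<gamma> zs t (zs ! t)) t) + ?dev"
  proof -
    have "(\<Sum>t\<in>?I. weighted_loss Ch \<Lambda> n ?W D t) \<le>
      (\<Sum>xs\<in>words n. ?W xs * ((\<Sum>zs\<in>words n. chn Ch xs zs * (\<Sum>t\<in>?I. \<Lambda> (xs ! t) (?\<gamma> zs t (zs ! t)))) + ?dev))"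
      unfolding sum_weighted_loss
    proof (intro sum_mono mult_left_mono block_prod_nonneg)
      fix xs :: "'x list" assume "xs \<in> words n"
      then have xs: "length xs = n" by simp
      show "(\<Sum>zs\<in>words n. chn Ch xs zs * (\<Sum>t\<in>?I. \<Lambda> (xs ! t) (D zs t)))
        \<le> (\<Sum>zs\<in>words n. chn Ch xs zs * (\<Sum>t\<in>?I. \<Lambda> (xs ! t) (?\<gamma> zs t (zs ! t)))) + ?dev"
      proof (rule sdude_vs_genie[OF st H xs k m M l D])
        show "?\<gamma> zs \<in> Skm k m zs" if "length zs = n" for zs
          using that as by (intro genie_Skm) simp_all
        show "?\<gamma> (zs[t := z]) t = ?\<gamma> zs t" if "k \<le> t" for zs t z
          by (rule genie_update[OF that])
      qed
    qed
    also have "\<dots> = (\<Sum>t\<in>?I. weighted_loss Ch \<Lambda> n ?W (\<lambda>zs t. ?\<gamma> zs t (zs ! t)) t) + (\<Sum>xs\<in>words n. ?W xs) * ?dev"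
      unfolding sum_weighted_loss by (simp only: distrib_left sum.distrib sum_distrib_right)
    finally show ?thesis by (simp only: W1 mult_1)
  qed
  have genie_t: "weighted_loss Ch \<Lambda> n ?W (\<lambda>zs t. ?\<gamma> zs t (zs ! t)) t
      \<le> ?lim t + \<Delta> + (if t \<in> bad then B else 0)" if t: "t \<in> ?I" for t
  proof (cases "t \<in> bad")
    case True
    have "weighted_loss Ch \<Lambda> n ?W (\<lambda>zs t. ?\<gamma> zs t (zs ! t)) t \<le> B" by (rule le_B)
    then show ?thesis
      using True bayes_lim_nonneg[where \<Lambda> = \<Lambda> and Q = "Q (as ! t)", OF st \<Lambda>] \<Delta>(2) by simp
  next
    case False
    have tn: "t < n" "t + k < n" "k \<le> t" using t by auto
    obtain s e where W: "block_at n ?W (Q (as ! t)) s e" and se: "s \<le> t" "t < e"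
      "s = 0 \<or> as ! (s - 1) \<noteq> as ! s" "e = n \<or> as ! (e - 1) \<noteq> as ! e"
      by (rule block_prod_block_at[OF tn(1) as(1) Q])
    have notbad: "as ! j = as ! Suc j" if "t \<le> j + k" "j < t + k" for j
    proof -
      have "Suc j < length as" using that tn as by simp
      then show ?thesis using False that unfolding bad_def by blast
    qed
    have "s + k \<le> t"
    proof (rule ccontr)
      assume c: "\<not> s + k \<le> t"
      then have s: "0 < s" using tn by simp
      then have "as ! (s - 1) = as ! Suc (s - 1)" using c se(1) by (intro notbad) auto
      then show False using s se(3) by simp
    qed
    moreover have "t + k < e"
    proof (rule ccontr)
      assume c: "\<not> t + k < e"
      then have "as ! (e - 1) = as ! Suc (e - 1)" using se(2) by (intro notbad) auto
      then show False using c tn se(2,4) by simp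
    qed
    moreover have mem: "as ! t \<in> set as" using tn as by simp
    ultimately have "weighted_loss Ch \<Lambda> n ?W (\<lambda>zs t. ?\<gamma> zs t (zs ! t)) t = bayes_risk Ch \<Lambda> (Q (as ! t)) (2 * k + 1) k"
      unfolding weighted_loss_def by (intro genie_loss[where Q = Q and as = as and t = t, OF st _ W] Q)
    then show ?thesis using \<Delta>(1)[OF mem] False by simp
  qed
  have I: "?I \<subseteq> {..<n}" by auto
  have "(\<Sum>t<n. weighted_loss Ch \<Lambda> n ?W D t)
    = (\<Sum>t\<in>{..<n} - ?I. weighted_loss Ch \<Lambda> n ?W D t) + (\<Sum>t\<in>?I. weighted_loss Ch \<Lambda> n ?W D t)"
    by (rule sum.subset_diff[OF I]) simp
  also have "\<dots> \<le> 2 * real k * B + ((\<Sum>t\<in>?I. ?lim t + \<Delta> + (if t \<in> bad then B else 0)) + ?dev)"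
  proof (rule add_mono)
    have "(\<Sum>t\<in>{..<n} - ?I. weighted_loss Ch \<Lambda> n ?W D t) \<le> (\<Sum>t\<in>{..<n} - ?I. B)"
      by (intro sum_mono le_B)
    also have "\<dots> = real (n - (n - 2 * k)) * B"
      by (simp add: card_Diff_subset[OF _ I] mult_2)
    also have "n - (n - 2 * k) = 2 * k" using k by simp
    finally show "(\<Sum>t\<in>{..<n} - ?I. weighted_loss Ch \<Lambda> n ?W D t) \<le> 2 * real k * B" by simp
    show "(\<Sum>t\<in>?I. weighted_loss Ch \<Lambda> n ?W D t)
      \<le> (\<Sum>t\<in>?I. ?lim t + \<Delta> + (if t \<in> bad then B else 0)) + ?dev"
      by (rule order_trans[OF in_I]) (intro add_right_mono sum_mono genie_t)
  qed
  also have "(\<Sum>t\<in>?I. ?lim t + \<Delta> + (if t \<in> bad then B else 0))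
    \<le> ((\<Sum>t<n. ?lim t) + real n * \<Delta>) + real (2 * k * m) * B"
  proof -
    have "(\<Sum>t\<in>?I. ?lim t + \<Delta>) \<le> (\<Sum>t<n. ?lim t + \<Delta>)"
      by (rule sum_mono2) (use bayes_lim_nonneg[where \<Lambda> = \<Lambda>, OF st \<Lambda>] \<Delta>(2) in \<open>auto intro: add_nonneg_nonneg\<close>)
    also have "\<dots> = (\<Sum>t<n. ?lim t) + real n * \<Delta>" by (simp add: sum.distrib)
    finally have 1: "(\<Sum>t\<in>?I. ?lim t + \<Delta>) \<le> (\<Sum>t<n. ?lim t) + real n * \<Delta>" .
    have "(\<Sum>t\<in>?I. if t \<in> bad then B else 0) = real (card (?I \<inter> bad)) * B"
      by (simp add: sum.If_cases)
    also have "\<dots> \<le> real (2 * k * m) * B"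
    proof (intro mult_right_mono B0 of_nat_mono)
      have fin: "finite bad"
        by (rule finite_subset[of _ "{..length as + k}"]) (auto simp: bad_def)
      have "card (?I \<inter> bad) \<le> card bad" by (rule card_mono[OF fin]) auto
      also have "\<dots> \<le> 2 * k * nswitch as" unfolding bad_def by (rule card_near_switch)
      also have "\<dots> \<le> 2 * k * m" using as by simp
      finally show "card (?I \<inter> bad) \<le> 2 * k * m" .
    qed
    finally show ?thesis using 1 by (simp add: sum.distrib)
  qed
  finally have "(\<Sum>t<n. weighted_loss Ch \<Lambda> n ?W D t) \<le>
    (\<Sum>t<n. ?lim t) + real n * \<Delta> + (2 * real k * B + real (2 * k * m) * B) + ?dev" by simp
  also have "2 * real k * B + real (2 * k * m) * B \<le> 2 * B * (real (k + 1) * real (m + 1))"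
    using B0 by (simp add: algebra_simps)
  finally show ?thesis by simp
qed

section \<open>Averaging over the regime string\<close>

lemma exp_loss_eq:
  assumes "\<And>xs. length xs = n \<Longrightarrow> pfx P xs = (\<Sum>as\<in>S. p as * block_prod Q as xs)"
  shows "exp_loss Ch \<Lambda> P n D =
    (\<Sum>as\<in>S. p as * ((1 / real n) * (\<Sum>t<n. weighted_loss Ch \<Lambda> n (block_prod Q as) D t)))"
proof -
  let ?L = "\<lambda>xs zs. (1 / real n) * (\<Sum>t<n. \<Lambda> (xs ! t) (D zs t))"
  have "exp_loss Ch \<Lambda> P n D = (\<Sum>xs\<in>words n. pfx P xs * (\<Sum>zs\<in>words n. chn Ch xs zs * ?L xs zs))"
    unfolding exp_loss_def sum_distrib_left
    by (intro sum.cong refl) (simp only: chn_def mem_Collect_eq mult.assoc)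
  also have "\<dots> = (\<Sum>xs\<in>words n. \<Sum>as\<in>S. p as * block_prod Q as xs * (\<Sum>zs\<in>words n. chn Ch xs zs * ?L xs zs))"
    by (intro sum.cong refl) (simp only: assms mem_Collect_eq sum_distrib_right)
  also have "\<dots> = (\<Sum>as\<in>S. \<Sum>xs\<in>words n. p as * block_prod Q as xs * (\<Sum>zs\<in>words n. chn Ch xs zs * ?L xs zs))"
    by (rule sum.swap)
  also have "\<dots> = (\<Sum>as\<in>S. p as * ((1 / real n) * (\<Sum>t<n. weighted_loss Ch \<Lambda> n (block_prod Q as) D t)))"
    unfolding sum_weighted_loss sum_distrib_left
    by (intro sum.cong refl) (simp only: mult_ac)
  finally show ?thesis .
qed

lemma exp_loss_nonneg:
  assumes "stochastic Ch" "\<And>x y. 0 \<le> \<Lambda> x y"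
  shows "0 \<le> exp_loss Ch \<Lambda> P n D"
proof -
  have "0 \<le> Ch x z" for x z using assms(1) by (simp add: stochastic_def)
  then show ?thesis
    unfolding exp_loss_def by (intro sum_nonneg mult_nonneg_nonneg prod_nonneg pfx_nonneg assms(2)) simp_all
qed

lemma DD_le:
  assumes "stochastic Ch" "\<And>x y. 0 \<le> \<Lambda> x y"
  shows "DD Ch \<Lambda> P n \<le> exp_loss Ch \<Lambda> P n D"
  unfolding DD_def
proof (rule cINF_lower)
  show "bdd_below (range (exp_loss Ch \<Lambda> P n))"
    by (rule bdd_belowI2[where m = 0]) (rule exp_loss_nonneg[OF assms])
qed simp

text \<open>On regime strings with too many switches the genie may be inadmissible; such strings
  carry no weight.\<close>

lemma pfx_zero_if_many_switches:
  assumes A: "is_process A" and sw: "AE \<omega> in A. nswitch (map \<omega> [0..<n]) \<le> m"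
    and as: "length as = n" "\<not> nswitch as \<le> m"
  shows "pfx A as = 0"
proof -
  have "AE \<omega> in A. \<omega> \<notin> {\<omega> \<in> space A. \<forall>i<length as. \<omega> i = as ! i}"
    using sw
  proof (rule AE_mp, intro AE_I2 impI notI)
    fix \<omega> assume le: "nswitch (map \<omega> [0..<n]) \<le> m"
      and "\<omega> \<in> {\<omega> \<in> space A. \<forall>i<length as. \<omega> i = as ! i}"
    then have "map \<omega> [0..<n] = as" using as by (intro nth_equalityI) auto
    then show False using le as by simp
  qed
  then have "{\<omega> \<in> space A. \<forall>i<length as. \<omega> i = as ! i} \<in> null_sets A"
    by (subst AE_iff_null_sets[OF cylinder_sets[OF A]]) simp
  then show ?thesis unfolding pfx_def measure_def by (simp only: null_setsD1 enn2real_0)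
qed

text \<open>For each regime string of positive weight the limiting risks separate the loss of the
  S-DUDE from that of any competitor \<open>D'\<close>. The error term is the same for all these
  strings, so it survives averaging, and the infimum over \<open>D'\<close> yields
  \<open>DD\<close>.\<close>

lemma regret_le:
  fixes \<Lambda> :: "'x::finite \<Rightarrow> 'xh::finite \<Rightarrow> real" and Ch :: "'x \<Rightarrow> 'z::finite \<Rightarrow> real"
    and P :: "(nat \<Rightarrow> 'x) measure"
  assumes st: "stochastic Ch" and H: "right_inverse Ch H"
    and \<Lambda>: "\<And>x y. 0 \<le> \<Lambda> x y" and B: "\<And>x y. \<Lambda> x y \<le> B"
    and k: "2 * k < n" and m: "m \<le> (n - 2 * k) div 2"
    and M: "\<And>x z s. \<bar>\<Lambda> x (s z) - ell Ch H \<Lambda> z s\<bar> \<le> M" and l: "0 < l" "l * M \<le> 1"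
    and D: "is_sdude Ch H \<Lambda> k m n D"
    and P: "is_process P" and A: "is_process A" and sw: "AE \<omega> in A. nswitch (map \<omega> [0..<n]) \<le> m"
    and Q: "\<And>a. a \<in> {1..N} \<Longrightarrow> is_stationary (Q a)"
    and mix: "\<And>xs. length xs = n \<Longrightarrow> pfx P xs =
       (\<Sum>as\<in>{as. length as = n \<and> set as \<subseteq> {1..N::nat}}. pfx A as * block_prod Q as xs)"
    and \<Delta>: "\<And>a. a \<in> {1..N} \<Longrightarrow> bayes_risk Ch \<Lambda> (Q a) (2 * k + 1) k \<le> bayes_lim Ch \<Lambda> (Q a) + \<Delta>" "0 \<le> \<Delta>"
  shows "exp_loss Ch \<Lambda> P n D - DD Ch \<Lambda> P n
    \<le> (1 / real n) * (real n * \<Delta> + 2 * B * (real (k + 1) * real (m + 1))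
      + (real (k + 1) * (real CARD('z) ^ (2 * k) * (real (n - 2 * k) * hb (real m / real (n - 2 * k))
          + real (m + 1) * ln (real CARD('z \<Rightarrow> 'xh)))) / l + l * M\<^sup>2 * real (n - 2 * k)))"
    (is "_ \<le> (1 / real n) * ?R")
proof -
  let ?S = "{as. length as = n \<and> set as \<subseteq> {1..N}}"
  let ?wl = "\<lambda>as D. \<Sum>t<n. weighted_loss Ch \<Lambda> n (block_prod Q as) D t"
  have n0: "0 < n" using k by simp
  have tot: "(\<Sum>xs\<in>words n. block_prod Q as xs) = 1" if as: "as \<in> ?S" for as
  proof -
    have stat: "is_stationary (Q a)" if "a \<in> set as" for a using as that Q by auto
    have len: "length as = n" using as by simp
    obtain s e where "block_at n (block_prod Q as) (Q (as ! 0)) s e"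
      by (rule block_prod_block_at[OF n0 len stat])
    moreover have "is_stationary (Q (as ! 0))" using stat n0 len by simp
    ultimately show ?thesis by (rule block_at_total)
  qed
  \<comment> \<open>The total weight of the regime strings is read off the mixture formula, since
    \<open>P\<close> and every block product have mass one.\<close>
  have "1 = (\<Sum>xs\<in>words n. pfx P xs)" by (simp add: sum_pfx_words[OF P])
  also have "\<dots> = (\<Sum>xs\<in>words n. \<Sum>as\<in>?S. pfx A as * block_prod Q as xs)"
    by (intro sum.cong refl mix) simp
  also have "\<dots> = (\<Sum>as\<in>?S. pfx A as * (\<Sum>xs\<in>words n. block_prod Q as xs))"
    unfolding sum_distrib_left by (rule sum.swap)
  also have "\<dots> = (\<Sum>as\<in>?S. pfx A as)"
    by (intro sum.cong refl) (simp only: tot mult_1_right)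
  finally have A1: "(\<Sum>as\<in>?S. pfx A as) = 1" by simp
  have el: "exp_loss Ch \<Lambda> P n D' = (\<Sum>as\<in>?S. pfx A as * ((1 / real n) * ?wl as D'))" for D'
    by (rule exp_loss_eq) (rule mix)
  have "exp_loss Ch \<Lambda> P n D - (1 / real n) * ?R \<le> exp_loss Ch \<Lambda> P n D'" for D'
  proof -
    have "exp_loss Ch \<Lambda> P n D \<le> (\<Sum>as\<in>?S. pfx A as * ((1 / real n) * (?wl as D' + ?R)))"
      unfolding el
    proof (rule sum_mono)
      fix as assume as: "as \<in> ?S"
      have len: "length as = n" using as by simp
      have mem: "a \<in> {1..N}" if "a \<in> set as" for a using as that by auto
      have stat: "is_stationary (Q a)" if "a \<in> set as" for a by (rule Q[OF mem[OF that]])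
      have gap: "bayes_risk Ch \<Lambda> (Q a) (2 * k + 1) k \<le> bayes_lim Ch \<Lambda> (Q a) + \<Delta>" if "a \<in> set as" for a
        by (rule \<Delta>(1)[OF mem[OF that]])
      show "pfx A as * ((1 / real n) * ?wl as D) \<le> pfx A as * ((1 / real n) * (?wl as D' + ?R))"
      proof (cases "nswitch as \<le> m")
        case True
        have "?wl as D \<le> (\<Sum>t<n. bayes_lim Ch \<Lambda> (Q (as ! t))) + ?R"
          using sdude_weighted_loss_le[where \<Lambda> = \<Lambda> and Q = Q, OF st H \<Lambda> B k m M l D len True stat gap \<Delta>(2)]
          by (simp only: add.assoc)
        also have "(\<Sum>t<n. bayes_lim Ch \<Lambda> (Q (as ! t))) \<le> ?wl as D'"
          by (intro sum_mono weighted_loss_ge[OF st \<Lambda> _ len stat]) simp_all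
        finally have "?wl as D \<le> ?wl as D' + ?R" by simp
        then show ?thesis by (intro mult_left_mono pfx_nonneg) simp_all
      next
        case False
        then show ?thesis using pfx_zero_if_many_switches[OF A sw len] by simp
      qed
    qed
    also have "\<dots> = exp_loss Ch \<Lambda> P n D' + (\<Sum>as\<in>?S. pfx A as) * ((1 / real n) * ?R)"
      unfolding el by (simp only: distrib_left sum.distrib sum_distrib_right)
    finally show ?thesis unfolding A1 by simp
  qed
  then have "exp_loss Ch \<Lambda> P n D - (1 / real n) * ?R \<le> DD Ch \<Lambda> P n"
    unfolding DD_def by (intro cINF_greatest) auto
  then show ?thesis by simp
qed

section \<open>From the summability hypothesis to the limit\<close>

lemma hb_nonneg:
  assumes "0 \<le> p" "p \<le> 1"
  shows "0 \<le> hb p"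
proof (cases "p = 0 \<or> p = 1")
  case False
  then have "0 < p" "p < 1" using assms by auto
  then have "p * ln p \<le> 0" "(1 - p) * ln (1 - p) \<le> 0"
    by (auto intro!: mult_nonneg_nonpos)
  then show ?thesis by (simp add: hb_def)
qed (auto simp: hb_def)

text \<open>The summands eventually fall below 2, although the prefactor is at least 2. So the
  exponential is below 1 and the bracket is positive, which bounds \<open>b n\<close> by
  \<open>\<epsilon>\<^sup>2 / (4 * (k n + 1) * L\<^sup>2)\<close>.\<close>

lemma summable_imp_complexity_tendsto_0:
  fixes k r :: "nat \<Rightarrow> nat" and b :: "nat \<Rightarrow> real"
  assumes r: "\<And>n. n \<ge> 1 \<Longrightarrow> 0 < r n" and b: "\<And>n. n \<ge> 1 \<Longrightarrow> 0 \<le> b n"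
    and sm: "\<And>\<epsilon>. 0 < \<epsilon> \<Longrightarrow> summable (\<lambda>n. 2 * real (k n + 1) *
      exp (- real (r n) * (\<epsilon>\<^sup>2 / (2 * real (k n + 1) * L\<^sup>2) - 2 * b n)))"
  shows "(\<lambda>n. real (k n + 1) * b n) \<longlonglongrightarrow> 0"
proof (rule tendstoI)
  fix \<delta> :: real assume \<delta>: "0 < \<delta>"
  \<comment> \<open>For \<open>L \<noteq> 0\<close> this gives
    \<open>\<epsilon>\<^sup>2 = 4 * \<delta> * L\<^sup>2\<close>, so that the bound on
    \<open>(k n + 1) * b n\<close> is exactly \<open>\<delta>\<close>.\<close>
  define \<epsilon> where "\<epsilon> = (if L = 0 then 1 else 2 * sqrt \<delta> * \<bar>L\<bar>)"
  have \<epsilon>: "0 < \<epsilon>" using \<delta> by (simp add: \<epsilon>_def)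
  have "eventually (\<lambda>n. 2 * real (k n + 1) *
      exp (- real (r n) * (\<epsilon>\<^sup>2 / (2 * real (k n + 1) * L\<^sup>2) - 2 * b n)) < 2) sequentially"
    by (rule order_tendstoD(2)[OF summable_LIMSEQ_zero[OF sm[OF \<epsilon>]]]) simp
  then show "eventually (\<lambda>n. dist (real (k n + 1) * b n) 0 < \<delta>) sequentially"
    using eventually_ge_at_top[of 1]
  proof eventually_elim
    case (elim n)
    let ?x = "\<epsilon>\<^sup>2 / (2 * real (k n + 1) * L\<^sup>2) - 2 * b n"
    have "exp (- real (r n) * ?x) < 1"
    proof (rule ccontr)
      assume "\<not> ?thesis"
      then have "2 * real (k n + 1) * 1 \<le> 2 * real (k n + 1) * exp (- real (r n) * ?x)"
        by (intro mult_left_mono) auto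
      also note elim(1)
      finally show False by simp
    qed
    then have "0 < real (r n) * ?x" by simp
    then have x: "0 < ?x" using r[OF elim(2)] by (simp add: zero_less_mult_iff)
    show ?case
    proof (cases "L = 0")
      \<comment> \<open>Division by zero yields \<open>0\<close>, so a positive bracket contradicts
        \<open>0 \<le> b n\<close>.\<close>
      case True
      then show ?thesis using x b[OF elim(2)] by simp
    next
      case False
      then have \<epsilon>2: "\<epsilon>\<^sup>2 = 4 * \<delta> * L\<^sup>2" using \<delta> by (simp add: \<epsilon>_def power_mult_distrib)
      have "4 * \<delta> * L\<^sup>2 / (2 * c * L\<^sup>2) = 2 * \<delta> / c" if "0 < c" for c
        using False that by (simp add: field_simps)
      from this[of "real (k n + 1)"]
      have "\<epsilon>\<^sup>2 / (2 * real (k n + 1) * L\<^sup>2) = 2 * \<delta> / real (k n + 1)"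
        unfolding \<epsilon>2 by (simp only: of_nat_0_less_iff zero_less_Suc Suc_eq_plus1[symmetric])
      then have "b n < \<delta> / real (k n + 1)" using x by simp
      then have "real (k n + 1) * b n < \<delta>" by (simp add: field_simps)
      then show ?thesis using b[OF elim(2)] by simp
    qed
  qed
qed

theorem theorem6:
  fixes Ch :: "'x::finite \<Rightarrow> 'z::finite \<Rightarrow> real"
    and H :: "'z \<Rightarrow> 'x \<Rightarrow> real"
    and \<Lambda> :: "'x \<Rightarrow> 'xh::finite \<Rightarrow> real"
    and k m :: "nat \<Rightarrow> nat"
    and D :: "nat \<Rightarrow> 'z list \<Rightarrow> nat \<Rightarrow> 'xh"
    and P :: "(nat \<Rightarrow> 'x) measure"
  assumes "stochastic Ch" and "full_row_rank Ch" and "right_inverse Ch H"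
    and "\<forall>x y. \<Lambda> x y \<ge> 0"
    and "\<forall>n\<ge>1. 2 * k n < n"
    and "\<forall>n\<ge>1. m n \<le> (n - 2 * k n) div 2"
    and "filterlim k at_top sequentially"
    and "\<forall>\<epsilon>>0. summable (\<lambda>n. 2 * real (k n + 1) *
           exp (- real (n - 2 * k n) *
             (\<epsilon>\<^sup>2 / (2 * real (k n + 1) * (L_max Ch H \<Lambda>)\<^sup>2)
              - 2 * real CARD('z) ^ (2 * k n) *
                (hb (real (m n) / real (n - 2 * k n))
                 + real (m n + 1) * ln (real CARD('z \<Rightarrow> 'xh)) / real (n - 2 * k n)))))"
    and "\<forall>n\<ge>1. is_sdude Ch H \<Lambda> (k n) (m n) n (D n)"
    and "classP m P"
  shows "(\<lambda>n. exp_loss Ch \<Lambda> P n (D n) - DD Ch \<Lambda> P n) \<longlonglongrightarrow> 0"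
proof -
  note st = assms(1) and H = assms(3)
  have \<Lambda>: "0 \<le> \<Lambda> x y" for x y using assms(4) by simp
  have k: "2 * k n < n" and m: "m n \<le> (n - 2 * k n) div 2"
    and D: "is_sdude Ch H \<Lambda> (k n) (m n) n (D n)" if "n \<ge> 1" for n
    using assms(5,6,9) that by auto
  have lower: "0 \<le> exp_loss Ch \<Lambda> P n (D n) - DD Ch \<Lambda> P n" for n
    using DD_le[where \<Lambda> = \<Lambda>, OF st \<Lambda>] by simp
  show ?thesis
  proof (cases "CARD('xh) = 1")
    \<comment> \<open>With one reconstruction symbol the logarithm of the number of rules is
      \<open>0\<close>, and the complexity term does not control \<open>m\<close>. But then all
      denoisers coincide and the regret is zero.\<close>
    case True
    then have one: "x = y" for x y :: 'xh
      by (metis UNIV_I card_1_singletonE singletonD)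
    have "D' = D n" for D' :: "'z list \<Rightarrow> nat \<Rightarrow> 'xh" and n
      using one by (intro ext)
    then have "exp_loss Ch \<Lambda> P n D' = exp_loss Ch \<Lambda> P n (D n)" for D' n
      by (rule arg_cong)
    then have "range (exp_loss Ch \<Lambda> P n) = range (\<lambda>_ :: 'z list \<Rightarrow> nat \<Rightarrow> 'xh. exp_loss Ch \<Lambda> P n (D n))" for n
      by (rule image_cong[OF refl])
    then have "DD Ch \<Lambda> P n = exp_loss Ch \<Lambda> P n (D n)" for n
      by (simp add: DD_def)
    then show ?thesis by simp
  next
    case False
    let ?r = "\<lambda>n. n - 2 * k n"
    define lN where "lN = ln (real CARD('z \<Rightarrow> 'xh))"
    \<comment> \<open>\<open>?r n * b n\<close> is the bound on the logarithm of the number of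
      admissible sequences.\<close>
    define b where "b = (\<lambda>n. real CARD('z) ^ (2 * k n) *
      (hb (real (m n) / real (?r n)) + real (m n + 1) * lN / real (?r n)))"
    have card_gt: "1 < CARD('z \<Rightarrow> 'xh)"
    proof -
      have "1 < CARD('xh)" using False zero_less_card_finite[where 'a = 'xh] by linarith
      also have "\<dots> = card (range (\<lambda>(y :: 'xh) (_ :: 'z). y))"
        by (rule card_image[symmetric]) (auto simp: inj_on_def fun_eq_iff)
      also have "\<dots> \<le> CARD('z \<Rightarrow> 'xh)" by (rule card_mono) auto
      finally show ?thesis .
    qed
    have lN: "0 < lN" using card_gt by (simp add: lN_def)
    have r: "0 < ?r n" if "n \<ge> 1" for n using k[OF that] by simp
    have hb0: "0 \<le> hb (real (m n) / real (?r n))" if "n \<ge> 1" for n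
      by (rule hb_nonneg) (use m[OF that] r[OF that] in auto)
    \<comment> \<open>The entropy is nonnegative and the power of \<open>CARD('z)\<close> is at
      least one, so both may be dropped. As \<open>lN\<close> is positive, this leaves control of
      \<open>m\<close> itself.\<close>
    have b_ge: "real (m n + 1) * lN / real (?r n) \<le> b n" if "n \<ge> 1" for n
    proof -
      have "1 * (0 + real (m n + 1) * lN / real (?r n)) \<le> b n"
        unfolding b_def using lN
        by (intro mult_mono add_mono hb0 that one_le_power) (auto simp: Suc_le_eq)
      then show ?thesis by simp
    qed
    have b0: "0 \<le> b n" if "n \<ge> 1" for n
      using lN by (intro order_trans[OF _ b_ge[OF that]]) simp
    have beta: "(\<lambda>n. real (k n + 1) * b n) \<longlonglongrightarrow> 0"
    proof (rule summable_imp_complexity_tendsto_0[OF r b0])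
      show "summable (\<lambda>n. 2 * real (k n + 1) *
          exp (- real (?r n) * (\<epsilon>\<^sup>2 / (2 * real (k n + 1) * (L_max Ch H \<Lambda>)\<^sup>2) - 2 * b n)))"
        if "0 < \<epsilon>" for \<epsilon>
        using assms(8)[rule_format, OF that] by (simp only: b_def lN_def mult.assoc)
    qed
    \<comment> \<open>Up to a constant, a bound on the share of positions lost at the borders and
      near switches.\<close>
    define g where "g = (\<lambda>n. real (k n + 1) * real (m n + 1) / real (?r n))"
    have gamma: "g \<longlonglongrightarrow> 0"
    proof (rule tendsto_sandwich[where f = "\<lambda>_. 0" and h = "\<lambda>n. (real (k n + 1) * b n) / lN"])
      show "eventually (\<lambda>n. g n \<le> (real (k n + 1) * b n) / lN) sequentially"
        using eventually_ge_at_top[of 1]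
      proof eventually_elim
        case (elim n)
        have "g n * lN = real (k n + 1) * (real (m n + 1) * lN / real (?r n))"
          by (simp add: g_def)
        also have "\<dots> \<le> real (k n + 1) * b n" by (intro mult_left_mono b_ge elim) simp
        finally show ?case using lN by (simp add: pos_le_divide_eq)
      qed
      show "(\<lambda>n. (real (k n + 1) * b n) / lN) \<longlonglongrightarrow> 0"
        using tendsto_divide[OF beta tendsto_const[of lN]] lN by simp
    qed (auto simp: g_def)
    obtain N Q A where P: "is_process P" and Q: "\<And>a. a \<in> {1..N::nat} \<Longrightarrow> is_stationary (Q a)"
      and A: "is_process A" and sw: "\<And>n. AE \<omega> in A. nswitch (map \<omega> [0..<n]) \<le> m n"
      and mix: "\<And>xs. pfx P xs =
           (\<Sum>as\<in>{as. length as = length xs \<and> set as \<subseteq> {1..N}}. pfx A as * block_prod Q as xs)"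
      using assms(10) unfolding classP_def by blast
    define gap where "gap = (\<lambda>a k. bayes_risk Ch \<Lambda> (Q a) (2 * k + 1) k - bayes_lim Ch \<Lambda> (Q a))"
    \<comment> \<open>The sum dominates the gap of each regime and still vanishes, because there are
      finitely many regimes.\<close>
    define \<Delta> where "\<Delta> = (\<lambda>n. \<Sum>a\<in>{1..N}. gap a (k n))"
    have gap0: "0 \<le> gap a j" for a j
      using bayes_lim_le_window[where \<Lambda> = \<Lambda>, OF st \<Lambda>] by (simp add: gap_def)
    have gap_le: "bayes_risk Ch \<Lambda> (Q a) (2 * k n + 1) (k n) \<le> bayes_lim Ch \<Lambda> (Q a) + \<Delta> n"
      if "a \<in> {1..N}" for a n
    proof -
      have "gap a (k n) \<le> \<Delta> n"
        unfolding \<Delta>_def by (rule member_le_sum[OF that]) (auto simp: gap0)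
      then show ?thesis by (simp add: gap_def)
    qed
    have \<Delta>0: "0 \<le> \<Delta> n" for n unfolding \<Delta>_def by (intro sum_nonneg gap0)
    have \<Delta>_lim: "\<Delta> \<longlonglongrightarrow> 0"
    proof -
      have "(\<lambda>n. gap a (k n)) \<longlonglongrightarrow> 0" if "a \<in> {1..N}" for a
      proof -
        have "gap a \<longlonglongrightarrow> bayes_lim Ch \<Lambda> (Q a) - bayes_lim Ch \<Lambda> (Q a)"
          unfolding gap_def by (intro tendsto_diff bayes_risk_tendsto[where \<Lambda> = \<Lambda>, OF st \<Lambda> Q[OF that]] tendsto_const)
        then show ?thesis using filterlim_compose[OF _ assms(7), of "gap a"] by simp
      qed
      then have "\<Delta> \<longlonglongrightarrow> (\<Sum>a\<in>{1..N}. 0)" unfolding \<Delta>_def by (intro tendsto_sum)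
      then show ?thesis by simp
    qed
    define B where "B = Max (range (\<lambda>(x, y). \<Lambda> x y))"
    have B: "\<Lambda> x y \<le> B" for x y
      unfolding B_def by (rule Max_ge) auto
    \<comment> \<open>The added \<open>1\<close> keeps \<open>M\<close> positive, as
      \<open>l\<close> is later defined by dividing by it.\<close>
    define M where "M = 1 + Max (range (\<lambda>(x, z, s). \<bar>\<Lambda> x (s z) - ell Ch H \<Lambda> z s\<bar>))"
    have M': "\<bar>\<Lambda> x (s z) - ell Ch H \<Lambda> z s\<bar> \<le> M - 1" for x z s
    proof -
      have "\<bar>\<Lambda> x (s z) - ell Ch H \<Lambda> z s\<bar> \<in> range (\<lambda>(x, z, s). \<bar>\<Lambda> x (s z) - ell Ch H \<Lambda> z s\<bar>)"
        by (rule image_eqI[where x = "(x, z, s)"]) simp_all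
      then show ?thesis unfolding M_def by (simp add: Max_ge)
    qed
    have M1: "1 \<le> M" using order_trans[OF abs_ge_zero M'] by simp
    have M: "\<bar>\<Lambda> x (s z) - ell Ch H \<Lambda> z s\<bar> \<le> M" for x z s using M'[of x s z] by simp
    have B0: "0 \<le> B" using \<Lambda> B order_trans by blast
    have upper: "exp_loss Ch \<Lambda> P n (D n) - DD Ch \<Lambda> P n
        \<le> \<Delta> n + 2 * B * g n + real (k n + 1) * b n / l + l * M\<^sup>2"
      if n: "n \<ge> 1" and l: "0 < l" "l * M \<le> 1" for n l
    proof -
      let ?X = "2 * B * (real (k n + 1) * real (m n + 1))
        + (real (k n + 1) * (real CARD('z) ^ (2 * k n) * (real (?r n) * hb (real (m n) / real (?r n))
          + real (m n + 1) * lN)) / l + l * M\<^sup>2 * real (?r n))"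
      have mix': "pfx P xs = (\<Sum>as\<in>{as. length as = n \<and> set as \<subseteq> {1..N}}. pfx A as * block_prod Q as xs)"
        if "length xs = n" for xs
        using mix[of xs] that by simp
      have X0: "0 \<le> ?X"
        using B0 hb0[OF n] lN l by (intro add_nonneg_nonneg mult_nonneg_nonneg divide_nonneg_nonneg) auto
      have "exp_loss Ch \<Lambda> P n (D n) - DD Ch \<Lambda> P n \<le> (1 / real n) * (real n * \<Delta> n + ?X)"
        using regret_le[where \<Lambda> = \<Lambda> and Q = Q and A = A and \<Delta> = "\<Delta> n", OF st H \<Lambda> B k[OF n] m[OF n] M l D[OF n] P A sw Q mix' gap_le \<Delta>0]
        by (simp only: lN_def add.assoc)
      also have "\<dots> = \<Delta> n + ?X / real n"
        using n by (simp add: field_simps)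
      \<comment> \<open>The smaller denominator brings the error into the form of \<open>b\<close>
        and \<open>g\<close>.\<close>
      also have "?X / real n \<le> ?X / real (?r n)"
        using r[OF n] by (intro divide_left_mono X0) auto
      also have "?X / real (?r n) = 2 * B * g n + real (k n + 1) * b n / l + l * M\<^sup>2"
      proof -
        have "(c * (x * y) + (x * (z * (\<rho> * h + y * w)) / l + q * \<rho>)) / \<rho> =
          c * (x * y / \<rho>) + x * (z * (h + y * w / \<rho>)) / l + q"
          if "0 < \<rho>" for c x y z \<rho> h w q :: real
          using that l by (simp add: field_simps)
        then show ?thesis unfolding g_def b_def using r[OF n] by (simp only: of_nat_0_less_iff)
      qed
      finally show ?thesis by simp
    qed
    show ?thesis
    proof (rule tendstoI)
      fix \<epsilon> :: real assume \<epsilon>: "0 < \<epsilon>"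
      \<comment> \<open>Both bounds on \<open>l\<close> are independent of \<open>n\<close>. The
        first makes the moment bound applicable, the second keeps \<open>l * M\<^sup>2\<close>
        within \<open>\<epsilon> / 2\<close>; the remaining terms vanish for this fixed
        \<open>l\<close>.\<close>
      define l where "l = min (1 / M) (\<epsilon> / (2 * M\<^sup>2))"
      have l: "0 < l" using M1 \<epsilon> by (simp add: l_def)
      have "l \<le> 1 / M" "l \<le> \<epsilon> / (2 * M\<^sup>2)" by (auto simp: l_def)
      then have lM: "l * M \<le> 1" "l * M\<^sup>2 \<le> \<epsilon> / 2" using M1 by (auto simp: field_simps)
      have "(\<lambda>n. \<Delta> n + 2 * B * g n + real (k n + 1) * b n / l) \<longlonglongrightarrow> 0 + 2 * B * 0 + 0 / l"
        by (intro tendsto_add tendsto_mult tendsto_divide tendsto_const \<Delta>_lim gamma beta) (use l in simp)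
      then have "eventually (\<lambda>n. \<Delta> n + 2 * B * g n + real (k n + 1) * b n / l < \<epsilon> / 2) sequentially"
        by (rule order_tendstoD(2)) (use \<epsilon> in simp)
      then show "eventually (\<lambda>n. dist (exp_loss Ch \<Lambda> P n (D n) - DD Ch \<Lambda> P n) 0 < \<epsilon>) sequentially"
        using eventually_ge_at_top[of 1]
      proof eventually_elim
        case (elim n)
        have "exp_loss Ch \<Lambda> P n (D n) - DD Ch \<Lambda> P n < \<epsilon>"
          using upper[OF elim(2) l lM(1)] elim(1) lM(2) by linarith
        then show ?case using lower[of n] by simp
      qed
    qed
  qed
qed

end
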